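(* For $i\in\{1,2\}$, let $S_i$ and $T_i$ be a primitive formally dual pair in a finite abelian group $G_i$. Partition $S_i$ as $S_i=S_{i0}\cup S_{i1}$. Define $$S_i'=\{(0,x)\mid x\in S_{i0}\}\cup\{(1,x)\mid x\in S_{i1}\},\qquad T_i'=\{(0,x)\mid x\in T_i\}\cup\{(1,x)\mid x\in T_i^{(-1)}\}.$$ For $i\in\{1,2\}$, assume that $S_i'$ and $T_i'$ form a primitive formally dual pair in $\mathbb{Z}_2\times G_i$. Define two subsets of $\mathbb{Z}_2\times G_1\times G_2$ by $$S''=\{(0,x_1,x_2)\mid (x_1,x_2)\in S_0''\}\cup\{(1,x_1,x_2)\mid (x_1,x_2)\in S_1''\},$$ $$T''=\{(0,x_1,x_2)\mid (x_1,x_2)\in T_1\times T_2\}\cup\{(1,x_1,x_2)\mid (x_1,x_2)\in T_1^{(-1)}\times T_2^{(-1)}\},$$ where $$S_0''=(S_{10}\times S_{20})\cup(S_{11}\times S_{21}),\qquad S_1''=(S_{10}\times S_{21})\cup(S_{11}\times S_{20}).$$ For $i\in\{1,2\}$, let $\{\chi_{i,z_i}\mid z_i\in G_i\}$ be the set of all characters on $G_i$. Then $S''$ and $T''$ form a primitive formally dual pair in $\mathbb{Z}_2\times G_1\times G_2$ if and only if one of the following holds: (1) for each $\chi_{1,z_1}\in\widehat{G_1}$, we have $\chi_{1,z_1}(T_1)^2\in\mathbb{R}$; (2) for each $\chi_{2,z_2}\in\widehat{G_2}$, we have $\chi_{2,z_2}(T_2)^2\in\mathbb{R}$. Moreover,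 $$\theta(T'',\mathbb{Z}_2\times G_1\times G_2)=2\cdot|G_1|\cdot|G_2|-|\{T_1T_1^{(-1)}\}|\cdot|\{T_2T_2^{(-1)}\}|-|\{T_1T_1+T_1^{(-1)}T_1^{(-1)}\}|\cdot|\{T_2T_2\}|.$$
   Context: All groups are finite abelian. For a group $G$ (written multiplicatively), $\widehat G$ is its group of characters (homomorphisms from $G$ to the multiplicative group of $\mathbb{C}$). A subset of $G$ is identified with the sum of its elements in the group ring $\mathbb{Z}[G]$. For $A=\sum_g a_g g\in\mathbb{Z}[G]$: $[A]_g=a_g$; $A^{(-1)}=\sum_g a_g g^{-1}$ (so for a subset $T$, $T^{(-1)}=\{t^{-1}\mid t\in T\}$); $\chi(A)=\sum_g a_g\chi(g)$ for $\chi\in\widehat G$; if all $a_g\ge 0$, $\{A\}$ denotes the set of $g\in G$ with $a_g>0$. Products and sums such as $T_1T_1$, $T_1T_1^{(-1)}$, $T_1T_1+T_1^{(-1)}T_1^{(-1)}$ are taken in the group ring. For a subset $A$ of $G$, $\theta(A,G)$ is the number of $g\in G$ with $[AA^{(-1)}]_g=0$, i.e. the frequency of $0$ in the multiset of all $[AA^{(-1)}]_g$, $g\in G$. For a subset $A$ of $G$ and $y\in G$, $\nu_A(y)=|\{(a_1,a_2)\in A\times A\mid y=a_1a_2^{-1}\}|$. Formally dual pair: let $\Delta:G\to\widehat G$ be a group isomorphism, $\Delta(y)=\chi_y$. Subsets $S,T$ of $G$ form a formally dual pair in $G$ under $\Delta$ if $|\chi_y(S)|^2=\frac{|S|^2}{|T|}\nu_T(y)$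 for each $y\in G$. The roles of $S$ and $T$ are interchangeable: this holds for each $y\in G$ if and only if $|\chi_y(T)|^2=\frac{|T|^2}{|S|}\nu_S(y)$ for each $y\in G$. When a formally dual pair is mentioned without naming an isomorphism, a proper isomorphism is assumed chosen. A subset of $G$ is primitive if it is not contained in a coset of a proper subgroup of $G$ and is not a union of cosets of a nontrivial subgroup of $G$. A formally dual pair is primitive if both of its subsets are primitive. Isomorphisms used: in $G_i$, $z_i\mapsto\chi_{i,z_i}$; in $\mathbb{Z}_2\times G_i$, $(w,z_i)\mapsto\big((a,b)\mapsto(-1)^{wa}\chi_{i,z_i}(b)\big)$; in $\mathbb{Z}_2\times G_1\times G_2$, $(w,z_1,z_2)\mapsto\big((a,b_1,b_2)\mapsto(-1)^{wa}\chi_{1,z_1}(b_1)\chi_{2,z_2}(b_2)\big)$.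
   Formalization: The printed formula for θ fails in general, even under (1); it is proved here under condition (2), and under condition (1) with the roles of T_1 and T_2 exchanged in the last product; nothing is claimed about θ when neither (1) nor (2) holds. *)

theory Defs
  imports Complex_Main "HOL-Library.Indicator_Function" "HOL-Algebra.Elementary_Groups"
begin

section \<open>Characters\<close>

definition complex_units :: "complex monoid" where
  "complex_units = \<lparr>carrier = UNIV - {0}, monoid.mult = (*), one = 1\<rparr>"

text \<open>Characters are taken to be extensional, so that two characters are equal as soon as they
  agree on the carrier of the group.\<close>

definition dual_group :: "('a, 'm) monoid_scheme \<Rightarrow> ('a \<Rightarrow> complex) monoid" where
  "dual_group G =
    \<lparr>carrier = hom G complex_units \<inter> extensional (carrier G),
     monoid.mult = (\<lambda>\<chi> \<psi>. \<lambda>x\<in>carrier G. \<chi> x * \<psi> x),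
     one = (\<lambda>x\<in>carrier G. 1)\<rparr>"

section \<open>The integral group ring of a finite group\<close>

text \<open>An element \<open>\<Sum> a\<^sub>g g\<close> is represented by its coefficient function \<open>g \<mapsto> a\<^sub>g\<close>; only the values
  on the carrier matter. A subset \<open>A\<close> is identified with its \<^const>\<open>indicator\<close> function.\<close>

definition gr_add :: "('a \<Rightarrow> int) \<Rightarrow> ('a \<Rightarrow> int) \<Rightarrow> 'a \<Rightarrow> int" where
  "gr_add A B = (\<lambda>g. A g + B g)"

definition gr_mult ::
  "('a, 'm) monoid_scheme \<Rightarrow> ('a \<Rightarrow> int) \<Rightarrow> ('a \<Rightarrow> int) \<Rightarrow> 'a \<Rightarrow> int" where
  "gr_mult G A B =
    (\<lambda>g. \<Sum>(h, k) | h \<in> carrier G \<and> k \<in> carrier G \<and> h \<otimes>\<^bsub>G\<^esub> k = g. A h * B k)"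

text \<open>The operation \<open>A \<mapsto> A\<^sup>(\<^sup>-\<^sup>1\<^sup>)\<close>: the coefficient of \<open>g\<close> in \<open>\<Sum> a\<^sub>h h\<^sup>-\<^sup>1\<close> is \<open>a\<^sub>h\<close> for \<open>h = g\<^sup>-\<^sup>1\<close>.\<close>

definition gr_inv :: "('a, 'm) monoid_scheme \<Rightarrow> ('a \<Rightarrow> int) \<Rightarrow> 'a \<Rightarrow> int" where
  "gr_inv G A = (\<lambda>g. A (inv\<^bsub>G\<^esub> g))"

definition gr_eval :: "('a, 'm) monoid_scheme \<Rightarrow> ('a \<Rightarrow> complex) \<Rightarrow> ('a \<Rightarrow> int) \<Rightarrow> complex" where
  "gr_eval G \<chi> A = (\<Sum>g\<in>carrier G. of_int (A g) * \<chi> g)"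

text \<open>The set \<open>{A}\<close>, meaningful for elements with nonnegative coefficients.\<close>

definition gr_supp :: "('a, 'm) monoid_scheme \<Rightarrow> ('a \<Rightarrow> int) \<Rightarrow> 'a set" where
  "gr_supp G A = {g \<in> carrier G. A g > 0}"

definition theta :: "'a set \<Rightarrow> ('a, 'm) monoid_scheme \<Rightarrow> nat" where
  "theta A G = card {g \<in> carrier G. gr_mult G (indicator A) (gr_inv G (indicator A)) g = 0}"

section \<open>Formally dual pairs\<close>

definition nu :: "('a, 'm) monoid_scheme \<Rightarrow> 'a set \<Rightarrow> 'a \<Rightarrow> nat" where
  "nu G A y = card {(a1, a2). a1 \<in> A \<and> a2 \<in> A \<and> y = a1 \<otimes>\<^bsub>G\<^esub> inv\<^bsub>G\<^esub> a2}"

text \<open>Nonemptiness is implicit in the division by \<open>|T|\<close>, and by \<open>|S|\<close> when the roles of the two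
  sets are interchanged.\<close>

definition formally_dual_pair ::
  "('a, 'm) monoid_scheme \<Rightarrow> ('a \<Rightarrow> 'a \<Rightarrow> complex) \<Rightarrow> 'a set \<Rightarrow> 'a set \<Rightarrow> bool" where
  "formally_dual_pair G \<Delta> S T \<longleftrightarrow>
     \<Delta> \<in> iso G (dual_group G) \<and>
     S \<subseteq> carrier G \<and> S \<noteq> {} \<and> T \<subseteq> carrier G \<and> T \<noteq> {} \<and>
     (\<forall>y\<in>carrier G.
        (cmod (gr_eval G (\<Delta> y) (indicator S)))\<^sup>2 = (real (card S))\<^sup>2 / real (card T) * real (nu G T y))"

definition primitive_subset :: "('a, 'm) monoid_scheme \<Rightarrow> 'a set \<Rightarrow> bool" where
  "primitive_subset G A \<longleftrightarrow>
     A \<subseteq> carrier G \<and>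
     \<not> (\<exists>H C. subgroup H G \<and> H \<noteq> carrier G \<and> C \<in> rcosets\<^bsub>G\<^esub> H \<and> A \<subseteq> C) \<and>
     \<not> (\<exists>H \<C>. subgroup H G \<and> H \<noteq> {\<one>\<^bsub>G\<^esub>} \<and> \<C> \<subseteq> rcosets\<^bsub>G\<^esub> H \<and> A = \<Union>\<C>)"

definition primitive_formally_dual_pair ::
  "('a, 'm) monoid_scheme \<Rightarrow> ('a \<Rightarrow> 'a \<Rightarrow> complex) \<Rightarrow> 'a set \<Rightarrow> 'a set \<Rightarrow> bool" where
  "primitive_formally_dual_pair G \<Delta> S T \<longleftrightarrow>
     formally_dual_pair G \<Delta> S T \<and> primitive_subset G S \<and> primitive_subset G T"

section \<open>Products with the group of order two\<close>

abbreviation Z2 :: "int monoid" where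
  "Z2 \<equiv> integer_mod_group 2"

text \<open>The map \<open>(w, z) \<mapsto> ((a, b) \<mapsto> (-1)\<^sup>w\<^sup>a \<chi>\<^sub>z(b))\<close>, where \<open>\<Delta> z = \<chi>\<^sub>z\<close>.\<close>

definition Z2_prod_iso ::
  "('a, 'm) monoid_scheme \<Rightarrow> ('a \<Rightarrow> 'a \<Rightarrow> complex) \<Rightarrow> int \<times> 'a \<Rightarrow> int \<times> 'a \<Rightarrow> complex" where
  "Z2_prod_iso G \<Delta> = (\<lambda>(w, z). \<lambda>(a, b)\<in>carrier (Z2 \<times>\<times> G). (-1) powi (w * a) * \<Delta> z b)"

definition prod_iso ::
  "('a, 'm) monoid_scheme \<Rightarrow> ('b, 'n) monoid_scheme \<Rightarrow> ('a \<Rightarrow> 'a \<Rightarrow> complex) \<Rightarrow>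
   ('b \<Rightarrow> 'b \<Rightarrow> complex) \<Rightarrow> 'a \<times> 'b \<Rightarrow> 'a \<times> 'b \<Rightarrow> complex" where
  "prod_iso G H \<Delta> \<Gamma> = (\<lambda>(z1, z2). \<lambda>(b1, b2)\<in>carrier (G \<times>\<times> H). \<Delta> z1 b1 * \<Gamma> z2 b2)"

definition Z2_set :: "'a set \<Rightarrow> 'a set \<Rightarrow> (int \<times> 'a) set" where
  "Z2_set A B = {(0, x) | x. x \<in> A} \<union> {(1, x) | x. x \<in> B}"

end

theory Submission
  imports Defs "HOL-Algebra.Multiplicative_Group"
begin

text \<open>
  Write \<open>P\<^sub>i = T\<^sub>iT\<^sub>i\<close>, \<open>Q\<^sub>i = T\<^sub>i\<^sup>(\<^sup>-\<^sup>1\<^sup>)T\<^sub>i\<^sup>(\<^sup>-\<^sup>1\<^sup>)\<close> and \<open>N\<^sub>i = T\<^sub>iT\<^sub>i\<^sup>(\<^sup>-\<^sup>1\<^sup>)\<close> for the group ring products, and call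
  \<open>{0} \<times> G\<close> and \<open>{1} \<times> G\<close> the layers of \<open>Z2 \<times>\<times> G\<close>. The product of \<open>T''\<close> with its inverse is
  \<open>2N\<^sub>1N\<^sub>2\<close> in layer \<open>0\<close> and \<open>P\<^sub>1P\<^sub>2 + Q\<^sub>1Q\<^sub>2\<close> in layer \<open>1\<close>. On the other side, the character of
  \<open>(w, y, z)\<close> takes at \<open>S''\<close> the product of the values of the characters of \<open>(w, y)\<close> at \<open>S\<^sub>1'\<close> and
  of \<open>(w, z)\<close> at \<open>S\<^sub>2'\<close>, whose absolute values are known from the given dual pairs.
  Comparing the two, the equation for \<open>S''\<close> and \<open>T''\<close> always holds in layer \<open>0\<close>, and in layer
  \<open>1\<close> it reads \<open>(P\<^sub>1 + Q\<^sub>1)(P\<^sub>2 + Q\<^sub>2) = 2(P\<^sub>1P\<^sub>2 + Q\<^sub>1Q\<^sub>2)\<close>, that is,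
  \<open>(P\<^sub>1 - Q\<^sub>1)(P\<^sub>2 - Q\<^sub>2) = 0\<close>, for the coefficients at all \<open>y\<close> and \<open>z\<close>. Hence \<open>S''\<close> and \<open>T''\<close> are
  formally dual exactly when \<open>P\<^sub>1 = Q\<^sub>1\<close> or \<open>P\<^sub>2 = Q\<^sub>2\<close> (\<open>formally_dual_pair_twisted_Times_iff\<close>).

  As \<open>\<chi>(Q\<^sub>i)\<close> is the complex conjugate of \<open>\<chi>(P\<^sub>i) = \<chi>(T\<^sub>i)\<^sup>2\<close>, Fourier inversion shows that
  \<open>P\<^sub>i = Q\<^sub>i\<close> means that all \<open>\<chi>(T\<^sub>i)\<^sup>2\<close> are real (\<open>gr_eval_square_real_iff\<close>). Inversion needs that
  characters separate points. This follows by double counting from the isomorphism between the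
  group and its dual that comes with a dual pair (\<open>sum_characters\<close>).

  Both \<open>S''\<close> and \<open>T''\<close> are primitive in any case (\<open>primitive_subset_Z2_set_twisted_Times\<close>,
  \<open>primitive_subset_Z2_set_Times_inv\<close>). For a nonempty set, primitivity means that its differences
  generate the group and that no nontrivial translation preserves it, and both conditions are
  inherited from the factors.

  Finally, if \<open>P\<^sub>2 = Q\<^sub>2\<close>, then \<open>P\<^sub>1P\<^sub>2 + Q\<^sub>1Q\<^sub>2 = (P\<^sub>1 + Q\<^sub>1)P\<^sub>2\<close>, whose support is a product set; with
  the support of \<open>N\<^sub>1N\<^sub>2\<close>, it gives the formula for \<open>\<theta>\<close>. The case \<open>P\<^sub>1 = Q\<^sub>1\<close> is symmetric.
\<close>

section \<open>Characters and Fourier inversion\<close>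

lemma dual_groupD:
  assumes "\<chi> \<in> carrier (dual_group G)"
  shows "\<chi> \<in> extensional (carrier G)"
    and "\<And>x. x \<in> carrier G \<Longrightarrow> \<chi> x \<noteq> 0"
    and "\<And>x y. x \<in> carrier G \<Longrightarrow> y \<in> carrier G \<Longrightarrow> \<chi> (x \<otimes>\<^bsub>G\<^esub> y) = \<chi> x * \<chi> y"
  using assms by (auto simp: dual_group_def complex_units_def hom_def)

lemma dual_groupI:
  assumes "\<chi> \<in> extensional (carrier G)"
    and "\<And>x. x \<in> carrier G \<Longrightarrow> \<chi> x \<noteq> 0"
    and "\<And>x y. x \<in> carrier G \<Longrightarrow> y \<in> carrier G \<Longrightarrow> \<chi> (x \<otimes>\<^bsub>G\<^esub> y) = \<chi> x * \<chi> y"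
  shows "\<chi> \<in> carrier (dual_group G)"
  using assms by (auto simp: dual_group_def complex_units_def hom_def)

lemma iso_dualD:
  assumes "\<Delta> \<in> iso G (dual_group G)"
  shows "\<And>y. y \<in> carrier G \<Longrightarrow> \<Delta> y \<in> carrier (dual_group G)"
    and "\<And>y z x. y \<in> carrier G \<Longrightarrow> z \<in> carrier G \<Longrightarrow> x \<in> carrier G \<Longrightarrow>
           \<Delta> (y \<otimes>\<^bsub>G\<^esub> z) x = \<Delta> y x * \<Delta> z x"
    and "inj_on \<Delta> (carrier G)"
    and "\<Delta> ` carrier G = carrier (dual_group G)"
  using assms by (auto simp: iso_def hom_def bij_betw_def dual_group_def)

context group
begin

lemma character_one:
  assumes "\<chi> \<in> carrier (dual_group G)"
  shows "\<chi> \<one> = 1"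
  using dual_groupD(2,3)[OF assms, of \<one>] by (metis l_one mult_cancel_left1 one_closed)

lemma character_inv_mult:
  assumes "\<chi> \<in> carrier (dual_group G)" and "x \<in> carrier G"
  shows "\<chi> (inv x) * \<chi> x = 1"
  using assms by (metis character_one dual_groupD(3) inv_closed l_inv)

lemma character_pow:
  assumes "\<chi> \<in> carrier (dual_group G)" and "x \<in> carrier G"
  shows "\<chi> (x [^] (n::nat)) = \<chi> x ^ n"
  using assms by (induction n) (auto simp: character_one dual_groupD(3))

lemma character_inv:
  assumes "finite (carrier G)" and "\<chi> \<in> carrier (dual_group G)" and "x \<in> carrier G"
  shows "\<chi> (inv x) = cnj (\<chi> x)"
proof -
  have "\<chi> x ^ order G = 1"
    using assms by (metis character_one character_pow pow_order_eq_1)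
  moreover have "order G > 0"
    using assms(1) by (simp add: order_gt_0_iff_finite)
  ultimately have "cmod (\<chi> x) = 1"
    by (metis norm_ge_zero norm_one norm_power order_less_irrefl power_eq_1_iff)
  then have "cnj (\<chi> x) * \<chi> x = 1"
    by (simp add: complex_norm_square[symmetric] mult.commute)
  with character_inv_mult[OF assms(2,3)] show ?thesis
    by (metis mult_cancel_right mult_zero_right zero_neq_one)
qed

lemma sum_translate:
  assumes "a \<in> carrier G"
  shows "(\<Sum>x\<in>carrier G. f (a \<otimes> x)) = (\<Sum>x\<in>carrier G. f x)"
  using assms
  by (intro sum.reindex_bij_witness[where i = "\<lambda>x. inv a \<otimes> x" and j = "\<lambda>x. a \<otimes> x"])
     (auto simp: m_assoc[symmetric])

lemma sum_inv:
  shows "(\<Sum>x\<in>carrier G. f (inv x)) = (\<Sum>x\<in>carrier G. f x)"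
  by (intro sum.reindex_bij_witness[where i = "\<lambda>x. inv x" and j = "\<lambda>x. inv x"]) auto

lemma sum_multiplicative_eq_0:
  fixes f :: "'a \<Rightarrow> complex"
  assumes "\<And>x y. x \<in> carrier G \<Longrightarrow> y \<in> carrier G \<Longrightarrow> f (x \<otimes> y) = f x * f y"
    and "a \<in> carrier G" and "f a \<noteq> 1"
  shows "(\<Sum>x\<in>carrier G. f x) = 0"
proof -
  have "(\<Sum>x\<in>carrier G. f x) = (\<Sum>x\<in>carrier G. f (a \<otimes> x))"
    using sum_translate[OF assms(2), of f] by simp
  also have "\<dots> = f a * (\<Sum>x\<in>carrier G. f x)"
    using assms by (simp add: sum_distrib_left)
  finally show ?thesis using assms(3) by (simp add: mult_cancel_right1)
qed

text \<open>Double counting of \<open>\<Sum>\<^sub>y \<Sum>\<^sub>h \<Delta>\<^sub>y(h)\<close>: summing over \<open>h\<close> first gives \<open>|G|\<close>, summing over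
  \<open>y\<close> first gives \<open>|G|\<close> times the number of elements on which all characters are trivial. So an
  isomorphism onto the dual group forces the characters to separate points.\<close>

lemma sum_characters:
  assumes fin: "finite (carrier G)" and \<Delta>: "\<Delta> \<in> iso G (dual_group G)" and h: "h \<in> carrier G"
  shows "(\<Sum>y\<in>carrier G. \<Delta> y h) = (if h = \<one> then of_nat (order G) else 0)"
proof -
  note D = iso_dualD[OF \<Delta>]
  have \<Delta>one: "\<Delta> \<one> x = 1" if "x \<in> carrier G" for x
    using D(2)[of \<one> \<one> x] dual_groupD(2)[OF D(1)[of \<one>]] that by simp
  define N where "N = {x \<in> carrier G. \<forall>y\<in>carrier G. \<Delta> y x = 1}"
  have NG: "N \<subseteq> carrier G" by (auto simp: N_def)
  have one: "\<one> \<in> N" using D(1) by (auto simp: N_def character_one)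
  have col: "(\<Sum>y\<in>carrier G. \<Delta> y x) = (if x \<in> N then of_nat (order G) else 0)"
    if x: "x \<in> carrier G" for x
  proof (cases "x \<in> N")
    case True
    then show ?thesis by (simp add: N_def order_def)
  next
    case False
    then obtain a where "a \<in> carrier G" "\<Delta> a x \<noteq> 1" using x by (auto simp: N_def)
    with sum_multiplicative_eq_0[of "\<lambda>y. \<Delta> y x" a] False D(2) x show ?thesis by simp
  qed
  have row: "(\<Sum>x\<in>carrier G. \<Delta> y x) = (if y = \<one> then of_nat (order G) else 0)"
    if y: "y \<in> carrier G" for y
  proof (cases "y = \<one>")
    case True
    then show ?thesis using \<Delta>one by (simp add: order_def)
  next
    case False
    have "\<exists>a\<in>carrier G. \<Delta> y a \<noteq> 1"
    proof (rule ccontr)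
      assume "\<not> ?thesis"
      then have "\<Delta> y = \<Delta> \<one>"
        using dual_groupD(1)[OF D(1)[OF y]] dual_groupD(1)[OF D(1)[OF one_closed]] \<Delta>one
        by (intro extensionalityI[where A = "carrier G"]) auto
      with D(3) y False show False by (auto dest: inj_onD)
    qed
    then obtain a where "a \<in> carrier G" "\<Delta> y a \<noteq> 1" by blast
    with sum_multiplicative_eq_0[of "\<Delta> y" a] dual_groupD(3)[OF D(1)[OF y]] False
    show ?thesis by simp
  qed
  have "of_nat (order G) * (of_nat (card N) :: complex) = (\<Sum>x\<in>N. of_nat (order G))"
    by simp
  also have "\<dots> = (\<Sum>x\<in>carrier G. if x \<in> N then of_nat (order G) else 0)"
    using fin NG by (simp add: sum.If_cases Int_absorb1)
  also have "\<dots> = (\<Sum>x\<in>carrier G. \<Sum>y\<in>carrier G. \<Delta> y x)"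
    by (rule sum.cong) (simp_all add: col)
  also have "\<dots> = (\<Sum>y\<in>carrier G. \<Sum>x\<in>carrier G. \<Delta> y x)"
    by (rule sum.swap)
  also have "\<dots> = (\<Sum>y\<in>carrier G. if y = \<one> then of_nat (order G) else 0)"
    by (rule sum.cong) (simp_all add: row)
  also have "\<dots> = of_nat (order G)"
    using fin by simp
  finally have "of_nat (card N) = (1::complex)"
    using fin order_gt_0_iff_finite by simp
  then have "card N = 1" by simp
  with one have "N = {\<one>}" by (metis card_1_singletonE singletonD)
  with col[OF h] show ?thesis by simp
qed

text \<open>Fourier inversion: an element of the group ring is determined by its character values.\<close>

lemma gr_eval_eq_0_imp:
  assumes fin: "finite (carrier G)" and \<Delta>: "\<Delta> \<in> iso G (dual_group G)"
    and f: "\<And>\<chi>. \<chi> \<in> carrier (dual_group G) \<Longrightarrow> gr_eval G \<chi> f = 0" and g: "g \<in> carrier G"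
  shows "f g = 0"
proof -
  note D = iso_dualD[OF \<Delta>]
  have "0 = (\<Sum>y\<in>carrier G. \<Delta> y (inv g) * gr_eval G (\<Delta> y) f)"
    using f D(1) by simp
  also have "\<dots> = (\<Sum>y\<in>carrier G. \<Sum>h\<in>carrier G. of_int (f h) * \<Delta> y (inv g \<otimes> h))"
    using g by (intro sum.cong)
      (auto simp: gr_eval_def sum_distrib_left dual_groupD(3)[OF D(1)] intro!: sum.cong)
  also have "\<dots> = (\<Sum>h\<in>carrier G. \<Sum>y\<in>carrier G. of_int (f h) * \<Delta> y (inv g \<otimes> h))"
    by (rule sum.swap)
  also have "\<dots> = (\<Sum>h\<in>carrier G. of_int (f h) * (if inv g \<otimes> h = \<one> then of_nat (order G) else 0))"
    using g by (intro sum.cong refl)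
      (simp only: sum_distrib_left[symmetric] sum_characters[OF fin \<Delta>] m_closed inv_closed)
  also have "\<dots> = (\<Sum>h\<in>carrier G. if h = g then of_int (f h) * of_nat (order G) else 0)"
  proof (intro sum.cong refl)
    fix h assume h: "h \<in> carrier G"
    have "inv g \<otimes> h = \<one> \<longleftrightarrow> h = g"
      using g h inv_solve_left'[of \<one> g h] by auto
    then show "of_int (f h) * (if inv g \<otimes> h = \<one> then of_nat (order G) else 0) =
        (if h = g then of_int (f h) * of_nat (order G) else (0::complex))"
      by simp
  qed
  also have "\<dots> = of_int (f g) * of_nat (order G)"
    using fin g by simp
  finally show ?thesis
    using fin order_gt_0_iff_finite by simp
qed

end

section \<open>The group ring\<close>

lemma gr_mult_nonneg:
  assumes "\<And>x. A x \<ge> 0" and "\<And>x. B x \<ge> 0"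
  shows "gr_mult G A B g \<ge> 0"
  unfolding gr_mult_def by (intro sum_nonneg) (auto simp: assms)

context group
begin

lemma gr_mult_eq:
  assumes "g \<in> carrier G"
  shows "gr_mult G A B g = (\<Sum>h\<in>carrier G. A h * B (inv h \<otimes> g))"
  unfolding gr_mult_def
  using assms
  by (intro sum.reindex_bij_witness[where j = fst and i = "\<lambda>h. (h, inv h \<otimes> g)"])
     (auto simp: m_assoc[symmetric])

lemma gr_eval_mult:
  assumes "\<chi> \<in> carrier (dual_group G)"
  shows "gr_eval G \<chi> (gr_mult G A B) = gr_eval G \<chi> A * gr_eval G \<chi> B"
proof -
  have "gr_eval G \<chi> (gr_mult G A B) =
      (\<Sum>g\<in>carrier G. \<Sum>h\<in>carrier G. of_int (A h) * of_int (B (inv h \<otimes> g)) * \<chi> g)"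
    by (simp add: gr_eval_def gr_mult_eq sum_distrib_right)
  also have "\<dots> = (\<Sum>h\<in>carrier G. \<Sum>g\<in>carrier G. of_int (A h) * of_int (B (inv h \<otimes> g)) * \<chi> g)"
    by (rule sum.swap)
  also have "\<dots> = (\<Sum>h\<in>carrier G. \<Sum>k\<in>carrier G. (of_int (A h) * \<chi> h) * (of_int (B k) * \<chi> k))"
  proof (rule sum.cong)
    fix h assume h: "h \<in> carrier G"
    have "(\<Sum>g\<in>carrier G. of_int (A h) * of_int (B (inv h \<otimes> g)) * \<chi> g) =
       (\<Sum>k\<in>carrier G. of_int (A h) * of_int (B (inv h \<otimes> (h \<otimes> k))) * \<chi> (h \<otimes> k))"
      using sum_translate[OF h, of "\<lambda>g. of_int (A h) * of_int (B (inv h \<otimes> g)) * \<chi> g"] by simp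
    also have "\<dots> = (\<Sum>k\<in>carrier G. (of_int (A h) * \<chi> h) * (of_int (B k) * \<chi> k))"
      using h by (intro sum.cong) (auto simp: dual_groupD(3)[OF assms] m_assoc[symmetric])
    finally show "(\<Sum>g\<in>carrier G. of_int (A h) * of_int (B (inv h \<otimes> g)) * \<chi> g) = \<dots>" .
  qed simp
  also have "\<dots> = gr_eval G \<chi> A * gr_eval G \<chi> B"
    by (simp add: gr_eval_def sum_product)
  finally show ?thesis .
qed

lemma gr_eval_inv:
  assumes "finite (carrier G)" and "\<chi> \<in> carrier (dual_group G)"
  shows "gr_eval G \<chi> (gr_inv G A) = cnj (gr_eval G \<chi> A)"
proof -
  have "gr_eval G \<chi> (gr_inv G A) = (\<Sum>g\<in>carrier G. of_int (A (inv g)) * cnj (\<chi> (inv g)))"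
    unfolding gr_eval_def gr_inv_def
    using assms by (intro sum.cong refl) (metis character_inv inv_closed inv_inv)
  also have "\<dots> = cnj (gr_eval G \<chi> A)"
    using sum_inv[of "\<lambda>g. of_int (A g) * cnj (\<chi> g)"] by (simp add: gr_eval_def)
  finally show ?thesis .
qed

lemma nu_eq_gr_mult:
  assumes "finite (carrier G)" and "A \<subseteq> carrier G" and "y \<in> carrier G"
  shows "int (nu G A y) = gr_mult G (indicator A) (gr_inv G (indicator A)) y"
proof -
  let ?P = "{(h, k). h \<in> carrier G \<and> k \<in> carrier G \<and> h \<otimes> k = y}"
  have fin: "finite ?P"
    using assms(1) by (intro finite_subset[OF _ finite_cartesian_product[of "carrier G" "carrier G"]]) auto
  have "nu G A y = card (?P \<inter> {(h, k). h \<in> A \<and> inv k \<in> A})"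
    unfolding nu_def
    by (intro bij_betw_same_card[of "\<lambda>(a, b). (a, inv b)"]
          bij_betw_byWitness[where f' = "\<lambda>(a, b). (a, inv b)"])
       (use assms(2) in \<open>auto simp: subset_iff\<close>)
  also have "int \<dots> = (\<Sum>(h, k)\<in>?P. if h \<in> A \<and> inv k \<in> A then 1 else 0)"
    using fin by (simp add: sum.If_cases case_prod_beta split_def)
  also have "\<dots> = gr_mult G (indicator A) (gr_inv G (indicator A)) y"
    unfolding gr_mult_def gr_inv_def by (intro sum.cong) (auto simp: indicator_def)
  finally show ?thesis .
qed

lemma mem_set_inv_iff:
  assumes "A \<subseteq> carrier G" and "x \<in> carrier G"
  shows "x \<in> set_inv A \<longleftrightarrow> inv x \<in> A"
proof
  assume "inv x \<in> A"
  then have "inv (inv x) \<in> set_inv A" unfolding SET_INV_def by blast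
  with assms show "x \<in> set_inv A" by simp
qed (use assms in \<open>auto simp: SET_INV_def subset_iff\<close>)

lemma set_inv_closed: "A \<subseteq> carrier G \<Longrightarrow> set_inv A \<subseteq> carrier G"
  by (auto simp: SET_INV_def)

lemma card_set_inv: "A \<subseteq> carrier G \<Longrightarrow> card (set_inv A) = card A"
  unfolding SET_INV_def UNION_singleton_eq_range
  by (rule card_image) (rule inj_on_subset[OF inv_inj])

end

lemma (in comm_group) gr_mult_commute: "gr_mult G A B g = gr_mult G B A g"
  unfolding gr_mult_def
  by (intro sum.reindex_bij_witness[where j = "\<lambda>(h,k). (k, h)" and i = "\<lambda>(h,k). (k, h)"])
     (auto simp: m_comm mult.commute)

text \<open>The values of \<open>\<chi>\<close> at \<open>AA\<close> and \<open>A\<^sup>(\<^sup>-\<^sup>1\<^sup>)A\<^sup>(\<^sup>-\<^sup>1\<^sup>)\<close> are \<open>\<chi>(A)\<^sup>2\<close> and its complex conjugate;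
  Fourier inversion turns equality of these values into equality of coefficients.\<close>

lemma (in group) gr_eval_square_real_iff:
  fixes A :: "'a \<Rightarrow> int"
  assumes fin: "finite (carrier G)" and \<Delta>: "\<Delta> \<in> iso G (dual_group G)"
  shows "(\<forall>\<chi>\<in>carrier (dual_group G). (gr_eval G \<chi> A)\<^sup>2 \<in> \<real>) \<longleftrightarrow>
    (\<forall>z\<in>carrier G. gr_mult G A A z = gr_mult G (gr_inv G A) (gr_inv G A) z)"
    (is "?R \<longleftrightarrow> (\<forall>z\<in>carrier G. ?P z = ?Q z)")
proof
  have ev: "gr_eval G \<chi> (\<lambda>z. ?P z - ?Q z) = (gr_eval G \<chi> A)\<^sup>2 - cnj ((gr_eval G \<chi> A)\<^sup>2)"
    if "\<chi> \<in> carrier (dual_group G)" for \<chi>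
  proof -
    have "gr_eval G \<chi> (\<lambda>z. ?P z - ?Q z) = gr_eval G \<chi> ?P - gr_eval G \<chi> ?Q"
      by (simp add: gr_eval_def left_diff_distrib sum_subtractf)
    then show ?thesis
      using that fin by (simp add: gr_eval_mult gr_eval_inv power2_eq_square)
  qed
  {
    assume ?R
    then have "gr_eval G \<chi> (\<lambda>z. ?P z - ?Q z) = 0" if "\<chi> \<in> carrier (dual_group G)" for \<chi>
      using ev[OF that] that by (metis Reals_cnj_iff right_minus_eq)
    from gr_eval_eq_0_imp[OF fin \<Delta> this] show "\<forall>z\<in>carrier G. ?P z = ?Q z" by force
  next
    assume "\<forall>z\<in>carrier G. ?P z = ?Q z"
    then have "gr_eval G \<chi> (\<lambda>z. ?P z - ?Q z) = 0" for \<chi>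
      by (simp add: gr_eval_def)
    with ev show ?R by (simp add: Reals_cnj_iff)
  }
qed

section \<open>Primitive subsets\<close>

text \<open>For a nonempty subset, primitivity says that its differences generate the group and that its
  stabilizer is trivial.\<close>

lemma (in comm_group) primitive_subset_iff:
  assumes fin: "finite (carrier G)" and AG: "A \<subseteq> carrier G" and ne: "A \<noteq> {}"
  shows "primitive_subset G A \<longleftrightarrow>
    (\<forall>K. subgroup K G \<longrightarrow> (\<forall>x\<in>A. \<forall>y\<in>A. x \<otimes> inv y \<in> K) \<longrightarrow> K = carrier G) \<and>
    (\<forall>h\<in>carrier G. (\<forall>x\<in>A. h \<otimes> x \<in> A) \<longrightarrow> h = \<one>)"
proof -
  have coset: "(\<exists>C\<in>rcosets K. A \<subseteq> C) \<longleftrightarrow> (\<forall>x\<in>A. \<forall>y\<in>A. x \<otimes> inv y \<in> K)"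
    if K: "subgroup K G" for K
  proof
    assume "\<exists>C\<in>rcosets K. A \<subseteq> C"
    then obtain a where a: "a \<in> carrier G" and sub: "A \<subseteq> K #> a"
      by (auto simp: RCOSETS_def)
    show "\<forall>x\<in>A. \<forall>y\<in>A. x \<otimes> inv y \<in> K"
    proof (intro ballI)
      fix x y assume "x \<in> A" "y \<in> A"
      with sub obtain k l where kl: "k \<in> K" "x = k \<otimes> a" "l \<in> K" "y = l \<otimes> a"
        by (auto simp: r_coset_def subset_iff) metis
      then have "k \<in> carrier G" "l \<in> carrier G" using subgroup.mem_carrier[OF K] by auto
      with kl a have "x \<otimes> inv y = k \<otimes> inv l"
        by (simp add: inv_mult_group m_assoc) (simp add: m_assoc[symmetric])
      with kl K show "x \<otimes> inv y \<in> K"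
        by (simp add: subgroup.m_closed subgroup.m_inv_closed)
    qed
  next
    assume diff: "\<forall>x\<in>A. \<forall>y\<in>A. x \<otimes> inv y \<in> K"
    obtain a where a: "a \<in> A" using ne by blast
    have "A \<subseteq> K #> a"
    proof
      fix x assume x: "x \<in> A"
      with a AG have "x = (x \<otimes> inv a) \<otimes> a" by (auto simp: m_assoc subset_iff)
      with diff x a show "x \<in> K #> a" by (auto simp: r_coset_def)
    qed
    with a AG show "\<exists>C\<in>rcosets K. A \<subseteq> C" by (auto simp: RCOSETS_def)
  qed
  have stab: "(\<exists>H. subgroup H G \<and> H \<noteq> {\<one>} \<and> (\<exists>\<C>. \<C> \<subseteq> rcosets H \<and> A = \<Union>\<C>)) \<longleftrightarrow>
    (\<exists>h\<in>carrier G. (\<forall>x\<in>A. h \<otimes> x \<in> A) \<and> h \<noteq> \<one>)"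
  proof
    assume "\<exists>H. subgroup H G \<and> H \<noteq> {\<one>} \<and> (\<exists>\<C>. \<C> \<subseteq> rcosets H \<and> A = \<Union>\<C>)"
    then obtain H \<C> where H: "subgroup H G" "H \<noteq> {\<one>}" and C: "\<C> \<subseteq> rcosets H" "A = \<Union>\<C>"
      by blast
    obtain h where h: "h \<in> H" "h \<noteq> \<one>"
      using H subgroup.one_closed[OF H(1)] by blast
    have hG: "h \<in> carrier G" using h(1) subgroup.mem_carrier[OF H(1)] by blast
    have "h \<otimes> x \<in> A" if "x \<in> A" for x
    proof -
      from that C(2) obtain D where D: "D \<in> \<C>" "x \<in> D" by blast
      with C(1) obtain a where a: "a \<in> carrier G" "D = H #> a" by (auto simp: RCOSETS_def)
      with D obtain k where k: "k \<in> H" "x = k \<otimes> a" by (auto simp: r_coset_def)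
      have "h \<otimes> x = (h \<otimes> k) \<otimes> a"
        using k a hG subgroup.mem_carrier[OF H(1) k(1)] by (simp add: m_assoc)
      with k h a H(1) have "h \<otimes> x \<in> D" by (auto simp: r_coset_def subgroup.m_closed)
      with D C(2) show ?thesis by blast
    qed
    with hG h show "\<exists>h\<in>carrier G. (\<forall>x\<in>A. h \<otimes> x \<in> A) \<and> h \<noteq> \<one>" by blast
  next
    assume "\<exists>h\<in>carrier G. (\<forall>x\<in>A. h \<otimes> x \<in> A) \<and> h \<noteq> \<one>"
    then obtain h where h: "h \<in> carrier G" "\<forall>x\<in>A. h \<otimes> x \<in> A" "h \<noteq> \<one>" by blast
    define H where "H = {h \<in> carrier G. \<forall>x\<in>A. h \<otimes> x \<in> A}"
    have finA: "finite A" using AG fin finite_subset by blast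
    have H: "subgroup H G"
    proof (rule subgroupI)
      show "H \<subseteq> carrier G" by (auto simp: H_def)
      have "\<one> \<in> H" using AG by (auto simp: H_def)
      then show "H \<noteq> {}" by blast
    next
      fix a b assume "a \<in> H" "b \<in> H"
      then show "a \<otimes> b \<in> H" using AG by (auto simp: H_def m_assoc subset_iff)
    next
      fix a assume a: "a \<in> H"
      \<comment> \<open>Translation by \<open>a\<close> is injective, so it permutes the finite set \<open>A\<close>.\<close>
      have inj: "inj_on (\<lambda>x. a \<otimes> x) A"
        using a AG by (auto simp: H_def intro: inj_on_subset[OF inj_on_cmult])
      have "(\<lambda>x. a \<otimes> x) ` A = A"
        using a by (intro endo_inj_surj[OF finA _ inj]) (auto simp: H_def)
      moreover have "inv a \<otimes> (a \<otimes> x) = x" if "x \<in> A" for x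
        using a that AG by (auto simp: H_def m_assoc[symmetric] subset_iff)
      ultimately have "inv a \<otimes> y \<in> A" if "y \<in> A" for y
        using that by (metis imageE)
      with a show "inv a \<in> H" by (auto simp: H_def)
    qed
    moreover have "H \<noteq> {\<one>}" using h by (auto simp: H_def)
    moreover have "A = \<Union>((\<lambda>x. H #> x) ` A)"
    proof
      show "A \<subseteq> \<Union>((\<lambda>x. H #> x) ` A)"
        using rcos_self[OF _ H] AG by blast
      show "\<Union>((\<lambda>x. H #> x) ` A) \<subseteq> A"
        by (auto simp: r_coset_def H_def)
    qed
    moreover have "(\<lambda>x. H #> x) ` A \<subseteq> rcosets H" using AG by (auto simp: RCOSETS_def)
    ultimately show "\<exists>H. subgroup H G \<and> H \<noteq> {\<one>} \<and> (\<exists>\<C>. \<C> \<subseteq> rcosets H \<and> A = \<Union>\<C>)"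
      by blast
  qed
  have "primitive_subset G A \<longleftrightarrow>
      \<not> (\<exists>K. subgroup K G \<and> K \<noteq> carrier G \<and> (\<exists>C\<in>rcosets K. A \<subseteq> C)) \<and>
      \<not> (\<exists>H. subgroup H G \<and> H \<noteq> {\<one>} \<and> (\<exists>\<C>. \<C> \<subseteq> rcosets H \<and> A = \<Union>\<C>))"
    using AG unfolding primitive_subset_def by blast
  also have "\<dots> \<longleftrightarrow>
      \<not> (\<exists>K. subgroup K G \<and> K \<noteq> carrier G \<and> (\<forall>x\<in>A. \<forall>y\<in>A. x \<otimes> inv y \<in> K)) \<and>
      \<not> (\<exists>h\<in>carrier G. (\<forall>x\<in>A. h \<otimes> x \<in> A) \<and> h \<noteq> \<one>)"
    by (simp only: stab coset cong: conj_cong)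
  finally show ?thesis by blast
qed

text \<open>A homomorphism maps the group generated by the differences of a primitive subset into every
  subgroup that contains the images of these differences.\<close>

lemma primitive_subset_hom_image:
  assumes G: "comm_group G" "finite (carrier G)" and A: "primitive_subset G A" "A \<noteq> {}"
    and W: "group W" and \<alpha>: "\<alpha> \<in> hom G W" and K: "subgroup K W"
    and diff: "\<And>x y. x \<in> A \<Longrightarrow> y \<in> A \<Longrightarrow> \<alpha> x \<otimes>\<^bsub>W\<^esub> inv\<^bsub>W\<^esub> \<alpha> y \<in> K"
    and u: "u \<in> carrier G"
  shows "\<alpha> u \<in> K"
proof -
  interpret G: comm_group G by fact
  interpret group_hom G W \<alpha>
    using W \<alpha> by (simp add: group_hom_def group_hom_axioms_def G.is_group)
  have AG: "A \<subseteq> carrier G" using A(1) by (simp add: primitive_subset_def)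
  define L where "L = {x \<in> carrier G. \<alpha> x \<in> K}"
  have "subgroup L G"
    using K by (intro G.subgroupI)
      (auto simp: L_def subgroup.one_closed subgroup.m_closed subgroup.m_inv_closed
        intro!: exI[of _ "\<one>\<^bsub>G\<^esub>"])
  moreover have "\<forall>x\<in>A. \<forall>y\<in>A. x \<otimes>\<^bsub>G\<^esub> inv\<^bsub>G\<^esub> y \<in> L"
    using AG diff by (auto simp: L_def subset_iff)
  ultimately have "L = carrier G"
    using A G.primitive_subset_iff[OF G(2) AG] by blast
  with u show ?thesis by (auto simp: L_def)
qed

section \<open>Primitive subsets of products with the group of order two\<close>

lemma carrier_Z2: "carrier Z2 = {0, 1}"
  by (auto simp: carrier_integer_mod_group)

lemma mem_Z2_set: "(c, x) \<in> Z2_set A B \<longleftrightarrow> c = 0 \<and> x \<in> A \<or> c = 1 \<and> x \<in> B"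
  by (auto simp: Z2_set_def)

lemma Z2_set_closed:
  "A \<subseteq> carrier G \<Longrightarrow> B \<subseteq> carrier G \<Longrightarrow> Z2_set A B \<subseteq> carrier (Z2 \<times>\<times> G)"
  by (auto simp: Z2_set_def carrier_Z2)

lemma card_Z2_set:
  assumes "finite A" and "finite B"
  shows "card (Z2_set A B) = card A + card B"
proof -
  have "Z2_set A B = Pair 0 ` A \<union> Pair 1 ` B"
    by (auto simp: Z2_set_def)
  also have "card \<dots> = card (Pair (0::int) ` A) + card (Pair (1::int) ` B)"
    using assms by (intro card_Un_disjoint) auto
  finally show ?thesis by (simp add: card_image inj_on_def)
qed

lemma DirProd_comm_group:
  assumes "comm_group G" and "comm_group H"
  shows "comm_group (G \<times>\<times> H)"
proof -
  interpret G: comm_group G by fact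
  interpret H: comm_group H by fact
  interpret GH: group "G \<times>\<times> H" using DirProd_group G.is_group H.is_group .
  show ?thesis
    by (rule GH.group_comm_groupI) (auto simp: G.m_comm H.m_comm)
qed

text \<open>A stabilizing element with \<open>Z2\<close>-component \<open>0\<close> stabilizes \<open>T\<close> and \<open>U\<close>. One of the form
  \<open>(1, g, h)\<close> exchanges \<open>T\<close> and \<open>T\<^sup>(\<^sup>-\<^sup>1\<^sup>)\<close> through \<open>g\<close>, so that \<open>(1, g)\<close> stabilizes
  \<open>{0} \<times> T \<union> {1} \<times> T\<^sup>(\<^sup>-\<^sup>1\<^sup>)\<close>; primitivity of that set for one of the two factors excludes this.\<close>

lemma primitive_subset_Z2_set_Times_inv:
  assumes G: "comm_group G" "finite (carrier G)" and H: "comm_group H" "finite (carrier H)"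
    and T: "primitive_subset G T" "T \<noteq> {}" and U: "primitive_subset H U" "U \<noteq> {}"
    and T': "primitive_subset (Z2 \<times>\<times> G) (Z2_set T (set_inv\<^bsub>G\<^esub> T))"
  shows "primitive_subset (Z2 \<times>\<times> G \<times>\<times> H)
           (Z2_set (T \<times> U) ((set_inv\<^bsub>G\<^esub> T) \<times> (set_inv\<^bsub>H\<^esub> U)))"
proof -
  interpret G: comm_group G by fact
  interpret H: comm_group H by fact
  interpret GH: comm_group "G \<times>\<times> H" using DirProd_comm_group G(1) H(1) .
  interpret ZG: comm_group "Z2 \<times>\<times> G" using DirProd_comm_group[OF abelian_integer_mod_group G(1)] .
  interpret W: comm_group "Z2 \<times>\<times> G \<times>\<times> H"
    using DirProd_comm_group[OF abelian_integer_mod_group GH.comm_group_axioms] .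
  let ?W = "Z2 \<times>\<times> G \<times>\<times> H"
  let ?Ti = "set_inv\<^bsub>G\<^esub> T" and ?Ui = "set_inv\<^bsub>H\<^esub> U"
  let ?A = "Z2_set (T \<times> U) (?Ti \<times> ?Ui)"
  have sub: "T \<subseteq> carrier G" "U \<subseteq> carrier H" using T U by (simp_all add: primitive_subset_def)
  note subi = G.set_inv_closed[OF sub(1)] H.set_inv_closed[OF sub(2)]
  obtain t u where t: "t \<in> T" and u: "u \<in> U" using T U by blast
  have ti: "inv\<^bsub>G\<^esub> t \<in> ?Ti" and ui: "inv\<^bsub>H\<^esub> u \<in> ?Ui" using t u by (auto simp: SET_INV_def)
  have A: "?A \<subseteq> carrier ?W" using sub subi by (intro Z2_set_closed) auto
  have A_ne: "?A \<noteq> {}" using t u by (auto simp: mem_Z2_set ex_in_conv[symmetric])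
  have fin: "finite (carrier ?W)" using G H by (simp add: carrier_Z2)
  have finZG: "finite (carrier (Z2 \<times>\<times> G))" using G by (simp add: carrier_Z2)
  have T'sub: "Z2_set T ?Ti \<subseteq> carrier (Z2 \<times>\<times> G)" using sub subi by (intro Z2_set_closed)
  have T'ne: "Z2_set T ?Ti \<noteq> {}" using t by (auto simp: mem_Z2_set ex_in_conv[symmetric])
  have "K = carrier ?W"
    if K: "subgroup K ?W" and diff: "\<forall>x\<in>?A. \<forall>y\<in>?A. x \<otimes>\<^bsub>?W\<^esub> inv\<^bsub>?W\<^esub> y \<in> K" for K
  proof -
    have 0: "(0, g, h) \<in> K" if "g \<in> carrier G" "h \<in> carrier H" for g h
    proof -
      have "(0, g, \<one>\<^bsub>H\<^esub>) \<in> K"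
      proof (rule primitive_subset_hom_image[OF G T W.is_group _ K, where \<alpha> = "\<lambda>g. (0, g, \<one>\<^bsub>H\<^esub>)"])
        fix x y assume xy: "x \<in> T" "y \<in> T"
        with u have "(0, x, u) \<otimes>\<^bsub>?W\<^esub> inv\<^bsub>?W\<^esub> (0, y, u) \<in> K" using diff by (auto simp: mem_Z2_set)
        with xy u sub show "(0, x, \<one>\<^bsub>H\<^esub>) \<otimes>\<^bsub>?W\<^esub> inv\<^bsub>?W\<^esub> (0, y, \<one>\<^bsub>H\<^esub>) \<in> K"
          by (auto simp: subset_iff)
      qed (use that in \<open>auto simp: hom_def\<close>)
      moreover have "(0, \<one>\<^bsub>G\<^esub>, h) \<in> K"
      proof (rule primitive_subset_hom_image[OF H U W.is_group _ K, where \<alpha> = "\<lambda>h. (0, \<one>\<^bsub>G\<^esub>, h)"])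
        fix x y assume xy: "x \<in> U" "y \<in> U"
        with t have "(0, t, x) \<otimes>\<^bsub>?W\<^esub> inv\<^bsub>?W\<^esub> (0, t, y) \<in> K" using diff by (auto simp: mem_Z2_set)
        with xy t sub show "(0, \<one>\<^bsub>G\<^esub>, x) \<otimes>\<^bsub>?W\<^esub> inv\<^bsub>?W\<^esub> (0, \<one>\<^bsub>G\<^esub>, y) \<in> K"
          by (auto simp: subset_iff)
      qed (use that in \<open>auto simp: hom_def\<close>)
      ultimately have "(0, g, \<one>\<^bsub>H\<^esub>) \<otimes>\<^bsub>?W\<^esub> (0, \<one>\<^bsub>G\<^esub>, h) \<in> K"
        by (rule subgroup.m_closed[OF K])
      then show ?thesis using that by simp
    qed
    have "(1, inv\<^bsub>G\<^esub> t, inv\<^bsub>H\<^esub> u) \<otimes>\<^bsub>?W\<^esub> inv\<^bsub>?W\<^esub> (0, t, u) \<in> K"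
      using diff t u ti ui by (auto simp: mem_Z2_set)
    then have "(1, inv\<^bsub>G\<^esub> t \<otimes>\<^bsub>G\<^esub> inv\<^bsub>G\<^esub> t, inv\<^bsub>H\<^esub> u \<otimes>\<^bsub>H\<^esub> inv\<^bsub>H\<^esub> u) \<in> K" (is "(1, ?g, ?h) \<in> K")
      using t u sub by (auto simp: subset_iff)
    then have "(1, ?g, ?h) \<otimes>\<^bsub>?W\<^esub> (0, inv\<^bsub>G\<^esub> ?g \<otimes>\<^bsub>G\<^esub> g, inv\<^bsub>H\<^esub> ?h \<otimes>\<^bsub>H\<^esub> h) \<in> K"
      if "g \<in> carrier G" "h \<in> carrier H" for g h
      using that t u sub by (intro subgroup.m_closed[OF K] 0) (auto simp: subset_iff)
    moreover have "(1, ?g, ?h) \<otimes>\<^bsub>?W\<^esub> (0, inv\<^bsub>G\<^esub> ?g \<otimes>\<^bsub>G\<^esub> g, inv\<^bsub>H\<^esub> ?h \<otimes>\<^bsub>H\<^esub> h) = (1, g, h)"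
      if "g \<in> carrier G" "h \<in> carrier H" for g h
    proof -
      have c: "?g \<in> carrier G" "?h \<in> carrier H" using t u sub by auto
      have "?g \<otimes>\<^bsub>G\<^esub> (inv\<^bsub>G\<^esub> ?g \<otimes>\<^bsub>G\<^esub> g) = g" "?h \<otimes>\<^bsub>H\<^esub> (inv\<^bsub>H\<^esub> ?h \<otimes>\<^bsub>H\<^esub> h) = h"
        using c that by (simp_all only: G.m_assoc[symmetric] H.m_assoc[symmetric] G.inv_closed
            H.inv_closed G.r_inv H.r_inv G.l_one H.l_one)
      then show ?thesis by simp
    qed
    ultimately have 1: "(1, g, h) \<in> K" if "g \<in> carrier G" "h \<in> carrier H" for g h
      using that by metis
    show ?thesis
      using 0 1 subgroup.subset[OF K] by (auto simp: carrier_Z2)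
  qed
  moreover have "w = \<one>\<^bsub>?W\<^esub>"
    if w: "w \<in> carrier ?W" and stab: "\<forall>x\<in>?A. w \<otimes>\<^bsub>?W\<^esub> x \<in> ?A" for w
  proof -
    obtain c g h where w_eq: "w = (c, g, h)" by (cases w) auto
    with w have g: "g \<in> carrier G" and h: "h \<in> carrier H" and c: "c = 0 \<or> c = 1"
      by (auto simp: carrier_Z2)
    show ?thesis
    proof (cases "c = 0")
      case True
      have mem: "g \<otimes>\<^bsub>G\<^esub> x \<in> T \<and> h \<otimes>\<^bsub>H\<^esub> y \<in> U" if "x \<in> T" "y \<in> U" for x y
        using stab[rule_format, of "(0, x, y)"] that True by (auto simp: w_eq mem_Z2_set)
      then have "g = \<one>\<^bsub>G\<^esub>"
        using G.primitive_subset_iff[OF G(2) sub(1) T(2)] T(1) g u by blast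
      moreover have "h = \<one>\<^bsub>H\<^esub>"
        using H.primitive_subset_iff[OF H(2) sub(2) U(2)] U(1) h mem t by blast
      ultimately show ?thesis using True by (simp add: w_eq)
    next
      case False
      with c have c: "c = 1" by simp
      have 1: "g \<otimes>\<^bsub>G\<^esub> x \<in> ?Ti" if "x \<in> T" for x
        using stab[rule_format, of "(0, x, u)"] that u c by (auto simp: w_eq mem_Z2_set)
      have 2: "g \<otimes>\<^bsub>G\<^esub> x \<in> T" if "x \<in> ?Ti" for x
        using stab[rule_format, of "(1, x, inv\<^bsub>H\<^esub> u)"] that ui c by (auto simp: w_eq mem_Z2_set)
      have "\<forall>x\<in>Z2_set T ?Ti. (1, g) \<otimes>\<^bsub>Z2 \<times>\<times> G\<^esub> x \<in> Z2_set T ?Ti"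
        using 1 2 by (auto simp: mem_Z2_set)
      moreover have "(1, g) \<in> carrier (Z2 \<times>\<times> G)" using g by (simp add: carrier_Z2)
      ultimately have "(1, g) = \<one>\<^bsub>Z2 \<times>\<times> G\<^esub>"
        using ZG.primitive_subset_iff[OF finZG T'sub T'ne] T' by blast
      then show ?thesis by simp
    qed
  qed
  ultimately show ?thesis
    using W.primitive_subset_iff[OF fin A A_ne] by blast
qed

text \<open>The set in the conclusion is the image of \<open>Z2_set A0 A1 \<times> Z2_set B0 B1\<close> under
  \<open>((a, x), (b, y)) \<mapsto> (a + b, x, y)\<close>, hence its differences generate. Its projection to the last
  two components is a bijection onto \<open>(A0 \<union> A1) \<times> (B0 \<union> B1)\<close>, hence its stabilizer is trivial.\<close>

lemma primitive_subset_Z2_set_twisted_Times: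
  assumes G: "comm_group G" "finite (carrier G)" and H: "comm_group H" "finite (carrier H)"
    and A: "primitive_subset G (A0 \<union> A1)" "A0 \<union> A1 \<noteq> {}" "A0 \<inter> A1 = {}"
    and B: "primitive_subset H (B0 \<union> B1)" "B0 \<union> B1 \<noteq> {}" "B0 \<inter> B1 = {}"
    and A': "primitive_subset (Z2 \<times>\<times> G) (Z2_set A0 A1)"
    and B': "primitive_subset (Z2 \<times>\<times> H) (Z2_set B0 B1)"
  shows "primitive_subset (Z2 \<times>\<times> G \<times>\<times> H)
           (Z2_set (A0 \<times> B0 \<union> A1 \<times> B1) (A0 \<times> B1 \<union> A1 \<times> B0))"
proof -
  interpret G: comm_group G by fact
  interpret H: comm_group H by fact
  interpret GH: comm_group "G \<times>\<times> H" using DirProd_comm_group G(1) H(1) .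
  have ZG: "comm_group (Z2 \<times>\<times> G)" using DirProd_comm_group[OF abelian_integer_mod_group G(1)] .
  have ZH: "comm_group (Z2 \<times>\<times> H)" using DirProd_comm_group[OF abelian_integer_mod_group H(1)] .
  interpret W: comm_group "Z2 \<times>\<times> G \<times>\<times> H"
    using DirProd_comm_group[OF abelian_integer_mod_group GH.comm_group_axioms] .
  let ?W = "Z2 \<times>\<times> G \<times>\<times> H"
  let ?A = "Z2_set (A0 \<times> B0 \<union> A1 \<times> B1) (A0 \<times> B1 \<union> A1 \<times> B0)"
  have sub: "A0 \<subseteq> carrier G" "A1 \<subseteq> carrier G" "B0 \<subseteq> carrier H" "B1 \<subseteq> carrier H"
    using A B by (simp_all add: primitive_subset_def)
  have S: "?A \<subseteq> carrier ?W" using sub by (intro Z2_set_closed) auto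
  have S_ne: "?A \<noteq> {}" using A(2) B(2) by (auto simp: mem_Z2_set ex_in_conv[symmetric])
  have fin: "finite (carrier ?W)" using G H by (simp add: carrier_Z2)
  have finZG: "finite (carrier (Z2 \<times>\<times> G))" using G by (simp add: carrier_Z2)
  have finZH: "finite (carrier (Z2 \<times>\<times> H))" using H by (simp add: carrier_Z2)
  have ne: "Z2_set A0 A1 \<noteq> {}" "Z2_set B0 B1 \<noteq> {}"
    using A(2) B(2) by (auto simp: mem_Z2_set ex_in_conv[symmetric])
  have mem: "((a + b) mod 2, x, y) \<in> ?A" if "(a, x) \<in> Z2_set A0 A1" "(b, y) \<in> Z2_set B0 B1" for a b x y
    using that by (auto simp: mem_Z2_set)
  have "K = carrier ?W"
    if K: "subgroup K ?W" and diff: "\<forall>x\<in>?A. \<forall>y\<in>?A. x \<otimes>\<^bsub>?W\<^esub> inv\<^bsub>?W\<^esub> y \<in> K" for K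
  proof -
    have K1: "(c, g, \<one>\<^bsub>H\<^esub>) \<in> K" if "c \<in> carrier Z2" "g \<in> carrier G" for c g
    proof -
      have "(\<lambda>(c, g). (c, g, \<one>\<^bsub>H\<^esub>)) (c, g) \<in> K"
      proof (rule primitive_subset_hom_image[OF ZG finZG A' ne(1) W.is_group _ K])
        fix x y assume xy: "x \<in> Z2_set A0 A1" "y \<in> Z2_set A0 A1"
        obtain a s a' s' where eq: "x = (a, s)" "y = (a', s')" by (cases x, cases y)
        obtain b r where br: "(b, r) \<in> Z2_set B0 B1" using ne(2) by auto
        have "((a + b) mod 2, s, r) \<otimes>\<^bsub>?W\<^esub> inv\<^bsub>?W\<^esub> ((a' + b) mod 2, s', r) \<in> K"
          using diff mem xy br unfolding eq by blast
        moreover have "s \<in> carrier G" "s' \<in> carrier G" "r \<in> carrier H" "a \<in> {0,1}" "a' \<in> {0,1}"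
            "b \<in> {0,1}"
          using xy br sub by (auto simp: eq mem_Z2_set)
        ultimately show "(\<lambda>(c, g). (c, g, \<one>\<^bsub>H\<^esub>)) x \<otimes>\<^bsub>?W\<^esub> inv\<^bsub>?W\<^esub> (\<lambda>(c, g). (c, g, \<one>\<^bsub>H\<^esub>)) y \<in> K"
          by (auto simp: eq carrier_Z2)
      qed (use that in \<open>auto simp: hom_def\<close>)
      then show ?thesis by simp
    qed
    have K2: "(0, \<one>\<^bsub>G\<^esub>, h) \<in> K" if "h \<in> carrier H" for h
    proof -
      have "(\<lambda>(c, h). (c, \<one>\<^bsub>G\<^esub>, h)) (0, h) \<in> K"
      proof (rule primitive_subset_hom_image[OF ZH finZH B' ne(2) W.is_group _ K])
        fix x y assume xy: "x \<in> Z2_set B0 B1" "y \<in> Z2_set B0 B1"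
        obtain a s a' s' where eq: "x = (a, s)" "y = (a', s')" by (cases x, cases y)
        obtain b r where br: "(b, r) \<in> Z2_set A0 A1" using ne(1) by auto
        have "((b + a) mod 2, r, s) \<otimes>\<^bsub>?W\<^esub> inv\<^bsub>?W\<^esub> ((b + a') mod 2, r, s') \<in> K"
          using diff mem xy br unfolding eq by blast
        moreover have "s \<in> carrier H" "s' \<in> carrier H" "r \<in> carrier G" "a \<in> {0,1}" "a' \<in> {0,1}"
            "b \<in> {0,1}"
          using xy br sub by (auto simp: eq mem_Z2_set)
        ultimately show "(\<lambda>(c, h). (c, \<one>\<^bsub>G\<^esub>, h)) x \<otimes>\<^bsub>?W\<^esub> inv\<^bsub>?W\<^esub> (\<lambda>(c, h). (c, \<one>\<^bsub>G\<^esub>, h)) y \<in> K"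
          by (auto simp: eq carrier_Z2)
      qed (use that in \<open>auto simp: hom_def\<close>)
      then show ?thesis by simp
    qed
    have "(c, g, h) \<in> K" if "c \<in> carrier Z2" "g \<in> carrier G" "h \<in> carrier H" for c g h
    proof -
      have "(c, g, \<one>\<^bsub>H\<^esub>) \<otimes>\<^bsub>?W\<^esub> (0, \<one>\<^bsub>G\<^esub>, h) \<in> K"
        using that by (intro subgroup.m_closed[OF K] K1 K2)
      then show ?thesis using that by (auto simp: carrier_Z2)
    qed
    then show ?thesis using subgroup.subset[OF K] by auto
  qed
  moreover have "w = \<one>\<^bsub>?W\<^esub>"
    if w: "w \<in> carrier ?W" and stab: "\<forall>x\<in>?A. w \<otimes>\<^bsub>?W\<^esub> x \<in> ?A" for w
  proof -
    obtain c g h where w_eq: "w = (c, g, h)" by (cases w) auto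
    with w have g: "g \<in> carrier G" and h: "h \<in> carrier H" and c: "c = 0 \<or> c = 1"
      by (auto simp: carrier_Z2)
    have lift: "\<exists>e. (e, x, y) \<in> ?A" if "x \<in> A0 \<union> A1" "y \<in> B0 \<union> B1" for x y
      using that by (auto simp: mem_Z2_set)
    have mv: "g \<otimes>\<^bsub>G\<^esub> x \<in> A0 \<union> A1 \<and> h \<otimes>\<^bsub>H\<^esub> y \<in> B0 \<union> B1"
      if xy: "x \<in> A0 \<union> A1" "y \<in> B0 \<union> B1" for x y
    proof -
      from lift[OF xy] obtain e where "(e, x, y) \<in> ?A" ..
      with stab have "(c, g, h) \<otimes>\<^bsub>?W\<^esub> (e, x, y) \<in> ?A" unfolding w_eq by blast
      then show ?thesis by (auto simp: mem_Z2_set)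
    qed
    have AB: "A0 \<union> A1 \<subseteq> carrier G" "B0 \<union> B1 \<subseteq> carrier H" using sub by auto
    obtain x y where xy: "x \<in> A0 \<union> A1" "y \<in> B0 \<union> B1" using A(2) B(2) by blast
    have g1: "g = \<one>\<^bsub>G\<^esub>"
      using G.primitive_subset_iff[OF G(2) AB(1) A(2)] A(1) g mv xy(2) by blast
    have h1: "h = \<one>\<^bsub>H\<^esub>"
      using H.primitive_subset_iff[OF H(2) AB(2) B(2)] B(1) h mv xy(1) by blast
    \<comment> \<open>The two layers \<open>A0 \<times> B0 \<union> A1 \<times> B1\<close> and \<open>A0 \<times> B1 \<union> A1 \<times> B0\<close> are disjoint, so
      translation by \<open>(1, \<one>, \<one>)\<close> does not preserve the set.\<close>
    from lift[OF xy] obtain e where e: "(e, x, y) \<in> ?A" ..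
    with stab have "(c, g, h) \<otimes>\<^bsub>?W\<^esub> (e, x, y) \<in> ?A" unfolding w_eq by blast
    moreover have "x \<in> carrier G" "y \<in> carrier H" using xy AB by auto
    ultimately have "((c + e) mod 2, x, y) \<in> ?A" by (simp add: g1 h1)
    with e c A(3) B(3) have "c = 0" by (auto simp: mem_Z2_set)
    then show ?thesis by (simp add: w_eq g1 h1)
  qed
  ultimately show ?thesis
    using W.primitive_subset_iff[OF fin S S_ne] by blast
qed

section \<open>Isomorphisms onto dual groups of products\<close>

lemma prod_iso_iso:
  assumes G: "group G" and H: "group H"
    and \<Delta>: "\<Delta> \<in> iso G (dual_group G)" and \<Gamma>: "\<Gamma> \<in> iso H (dual_group H)"
  shows "prod_iso G H \<Delta> \<Gamma> \<in> iso (G \<times>\<times> H) (dual_group (G \<times>\<times> H))"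
proof -
  interpret G: group G by fact
  interpret H: group H by fact
  note D = iso_dualD[OF \<Delta>] and E = iso_dualD[OF \<Gamma>]
  note D' = dual_groupD[OF D(1)] and E' = dual_groupD[OF E(1)]
  let ?\<Theta> = "prod_iso G H \<Delta> \<Gamma>"
  have app: "?\<Theta> (y, z) (a, b) = \<Delta> y a * \<Gamma> z b" if "a \<in> carrier G" "b \<in> carrier H" for y z a b
    using that by (simp add: prod_iso_def)
  have into: "?\<Theta> (y, z) \<in> carrier (dual_group (G \<times>\<times> H))"
    if "y \<in> carrier G" "z \<in> carrier H" for y z
    by (rule dual_groupI) (use that D' E' in \<open>auto simp: prod_iso_def\<close>)
  have "?\<Theta> \<in> hom (G \<times>\<times> H) (dual_group (G \<times>\<times> H))"
  proof (rule homI)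
    show "?\<Theta> p \<in> carrier (dual_group (G \<times>\<times> H))" if "p \<in> carrier (G \<times>\<times> H)" for p
      using that into by (cases p) simp
    show "?\<Theta> (p \<otimes>\<^bsub>G \<times>\<times> H\<^esub> q) = ?\<Theta> p \<otimes>\<^bsub>dual_group (G \<times>\<times> H)\<^esub> ?\<Theta> q"
      if "p \<in> carrier (G \<times>\<times> H)" "q \<in> carrier (G \<times>\<times> H)" for p q
      using that D(2) E(2) by (auto simp: dual_group_def prod_iso_def fun_eq_iff restrict_def)
  qed
  moreover have "inj_on ?\<Theta> (carrier (G \<times>\<times> H))"
  proof (rule inj_onI)
    fix p q assume pq: "p \<in> carrier (G \<times>\<times> H)" "q \<in> carrier (G \<times>\<times> H)" "?\<Theta> p = ?\<Theta> q"
    obtain y z y' z' where eq: "p = (y, z)" "q = (y', z')" by (cases p, cases q)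
    have c: "y \<in> carrier G" "z \<in> carrier H" "y' \<in> carrier G" "z' \<in> carrier H"
      using pq by (auto simp: eq)
    have "\<Delta> y a = \<Delta> y' a" if "a \<in> carrier G" for a
      using fun_cong[OF pq(3), of "(a, \<one>\<^bsub>H\<^esub>)"] that c
      by (simp add: eq app H.character_one[OF E(1)])
    then have "\<Delta> y = \<Delta> y'"
      using D'(1) c by (intro extensionalityI[where A = "carrier G"]) auto
    moreover have "\<Gamma> z b = \<Gamma> z' b" if "b \<in> carrier H" for b
      using fun_cong[OF pq(3), of "(\<one>\<^bsub>G\<^esub>, b)"] that c
      by (simp add: eq app G.character_one[OF D(1)])
    then have "\<Gamma> z = \<Gamma> z'"
      using E'(1) c by (intro extensionalityI[where A = "carrier H"]) auto
    ultimately show "p = q" using c D(3) E(3) by (auto simp: eq dest: inj_onD)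
  qed
  moreover have "\<chi> \<in> ?\<Theta> ` carrier (G \<times>\<times> H)" if \<chi>: "\<chi> \<in> carrier (dual_group (G \<times>\<times> H))" for \<chi>
  proof -
    note X = dual_groupD[OF \<chi>]
    have X3: "\<chi> (a \<otimes>\<^bsub>G\<^esub> a', b \<otimes>\<^bsub>H\<^esub> b') = \<chi> (a, b) * \<chi> (a', b')"
      if "a \<in> carrier G" "a' \<in> carrier G" "b \<in> carrier H" "b' \<in> carrier H" for a a' b b'
      using X(3)[of "(a, b)" "(a', b')"] that by simp
    have "(\<lambda>a\<in>carrier G. \<chi> (a, \<one>\<^bsub>H\<^esub>)) \<in> carrier (dual_group G)"
      by (rule dual_groupI) (use X(2) X3[of _ _ "\<one>\<^bsub>H\<^esub>" "\<one>\<^bsub>H\<^esub>"] in auto)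
    then obtain y where y: "y \<in> carrier G" "\<Delta> y = (\<lambda>a\<in>carrier G. \<chi> (a, \<one>\<^bsub>H\<^esub>))"
      using D(4) by (metis imageE)
    have "(\<lambda>b\<in>carrier H. \<chi> (\<one>\<^bsub>G\<^esub>, b)) \<in> carrier (dual_group H)"
      by (rule dual_groupI) (use X(2) X3[of "\<one>\<^bsub>G\<^esub>" "\<one>\<^bsub>G\<^esub>"] in auto)
    then obtain z where z: "z \<in> carrier H" "\<Gamma> z = (\<lambda>b\<in>carrier H. \<chi> (\<one>\<^bsub>G\<^esub>, b))"
      using E(4) by (metis imageE)
    have "?\<Theta> (y, z) = \<chi>"
    proof (rule extensionalityI)
      show "?\<Theta> (y, z) \<in> extensional (carrier (G \<times>\<times> H))"
        using dual_groupD(1)[OF into] y z by simp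
      fix p assume "p \<in> carrier (G \<times>\<times> H)"
      then show "?\<Theta> (y, z) p = \<chi> p"
        using X3[of "fst p" "\<one>\<^bsub>G\<^esub>" "\<one>\<^bsub>H\<^esub>" "snd p"] by (cases p) (auto simp: app y z)
    qed (use X(1) in simp)
    with y z show ?thesis by force
  qed
  ultimately show ?thesis
    using into by (auto simp: iso_def bij_betw_def)
qed

text \<open>The isomorphism \<open>w \<mapsto> (a \<mapsto> (-1)\<^sup>w\<^sup>a)\<close> of the group of order two onto its dual. With it,
  \<^const>\<open>Z2_prod_iso\<close> becomes an instance of \<^const>\<open>prod_iso\<close>.\<close>

definition Z2_dual :: "int \<Rightarrow> int \<Rightarrow> complex" where
  "Z2_dual w = (\<lambda>a\<in>carrier Z2. (-1) powi (w * a))"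

lemma Z2_prod_iso_eq: "Z2_prod_iso G \<Delta> = prod_iso Z2 G Z2_dual \<Delta>"
  by (auto simp: Z2_prod_iso_def prod_iso_def Z2_dual_def fun_eq_iff restrict_def)

lemma Z2_dual_iso: "Z2_dual \<in> iso Z2 (dual_group Z2)"
proof -
  have into: "Z2_dual w \<in> carrier (dual_group Z2)" if "w \<in> carrier Z2" for w
    by (rule dual_groupI) (use that in \<open>auto simp: Z2_dual_def carrier_Z2\<close>)
  have "Z2_dual \<in> hom Z2 (dual_group Z2)"
  proof (rule homI)
    show "Z2_dual (v \<otimes>\<^bsub>Z2\<^esub> w) = Z2_dual v \<otimes>\<^bsub>dual_group Z2\<^esub> Z2_dual w"
      if "v \<in> carrier Z2" "w \<in> carrier Z2" for v w
      using that by (auto simp: dual_group_def Z2_dual_def carrier_Z2 fun_eq_iff restrict_def)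
  qed (rule into)
  moreover have "Z2_dual 0 1 \<noteq> Z2_dual 1 1" by (simp add: Z2_dual_def)
  then have "inj_on Z2_dual (carrier Z2)"
    by (auto simp: carrier_Z2 inj_on_def)
  moreover have "\<chi> \<in> Z2_dual ` carrier Z2" if \<chi>: "\<chi> \<in> carrier (dual_group Z2)" for \<chi>
  proof -
    have 0: "\<chi> 0 = 1"
      using group.character_one[OF group_integer_mod_group \<chi>] by simp
    have "\<chi> 1 * \<chi> 1 = \<chi> 0"
      using dual_groupD(3)[OF \<chi>, of 1 1] by (simp add: carrier_Z2)
    with 0 have "\<chi> 1 = 1 \<or> \<chi> 1 = -1" by (simp add: square_eq_1_iff)
    then have "\<chi> = Z2_dual 0 \<or> \<chi> = Z2_dual 1"
      using dual_groupD(1)[OF \<chi>] 0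
      by (auto simp: Z2_dual_def carrier_Z2 fun_eq_iff extensional_def)
    then show ?thesis by (auto simp: carrier_Z2)
  qed
  ultimately show ?thesis
    using into by (auto simp: iso_def bij_betw_def)
qed

lemma Z2_prod_iso_iso:
  assumes "group G" and "\<Delta> \<in> iso G (dual_group G)"
  shows "Z2_prod_iso G \<Delta> \<in> iso (Z2 \<times>\<times> G) (dual_group (Z2 \<times>\<times> G))"
  unfolding Z2_prod_iso_eq
  by (rule prod_iso_iso[OF group_integer_mod_group assms(1) Z2_dual_iso assms(2)])

section \<open>Character values and group ring products in direct products\<close>

lemma gr_eval_prod_iso:
  "gr_eval (G \<times>\<times> H) (prod_iso G H \<Delta> \<Gamma> (y, z)) (indicator (A \<times> B)) =
     gr_eval G (\<Delta> y) (indicator A) * gr_eval H (\<Gamma> z) (indicator B)"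
  by (auto simp: gr_eval_def prod_iso_def sum_product sum.cartesian_product indicator_def
      intro!: sum.cong)

lemma gr_eval_Un:
  assumes "A \<inter> B = {}"
  shows "gr_eval G \<chi> (indicator (A \<union> B)) = gr_eval G \<chi> (indicator A) + gr_eval G \<chi> (indicator B)"
  using assms unfolding gr_eval_def sum.distrib[symmetric]
  by (intro sum.cong) (auto simp: indicator_def)

lemma gr_eval_Z2_set:
  "gr_eval (Z2 \<times>\<times> G) (Z2_prod_iso G \<Delta> (w, z)) (indicator (Z2_set A B)) =
     gr_eval G (\<Delta> z) (indicator A) + (-1) powi w * gr_eval G (\<Delta> z) (indicator B)"
proof -
  have "gr_eval (Z2 \<times>\<times> G) (Z2_prod_iso G \<Delta> (w, z)) (indicator (Z2_set A B)) =
      (\<Sum>a\<in>{0, 1}. \<Sum>x\<in>carrier G.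
        of_int (indicator (Z2_set A B) (a, x)) * ((-1) powi (w * a) * \<Delta> z x))"
    by (auto simp: gr_eval_def Z2_prod_iso_def sum.cartesian_product carrier_Z2 intro!: sum.cong)
  also have "\<dots> = gr_eval G (\<Delta> z) (indicator A) + (-1) powi w * gr_eval G (\<Delta> z) (indicator B)"
    by (simp add: gr_eval_def sum_distrib_left indicator_def mem_Z2_set mult.left_commute)
  finally show ?thesis .
qed

lemma gr_mult_Times:
  assumes "group G" and "group H" and "g \<in> carrier G" and "h \<in> carrier H"
    and "\<And>x y. x \<in> carrier G \<Longrightarrow> y \<in> carrier H \<Longrightarrow> P (x, y) = A x * C y"
    and "\<And>x y. x \<in> carrier G \<Longrightarrow> y \<in> carrier H \<Longrightarrow> Q (x, y) = B x * D y"
  shows "gr_mult (G \<times>\<times> H) P Q (g, h) = gr_mult G A B g * gr_mult H C D h"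
proof -
  interpret G: group G by fact
  interpret H: group H by fact
  interpret GH: group "G \<times>\<times> H" using DirProd_group assms(1,2) .
  show ?thesis
    using assms(3-)
    by (simp add: GH.gr_mult_eq G.gr_mult_eq H.gr_mult_eq sum_product sum.cartesian_product)
       (auto intro!: sum.cong)
qed

text \<open>For \<open>T' = {0} \<times> T \<union> {1} \<times> T\<^sup>(\<^sup>-\<^sup>1\<^sup>)\<close>, the product of \<open>T'\<close> with its inverse consists of
  \<open>TT\<^sup>(\<^sup>-\<^sup>1\<^sup>) + T\<^sup>(\<^sup>-\<^sup>1\<^sup>)T = 2TT\<^sup>(\<^sup>-\<^sup>1\<^sup>)\<close> in layer \<open>0\<close> and \<open>TT + T\<^sup>(\<^sup>-\<^sup>1\<^sup>)T\<^sup>(\<^sup>-\<^sup>1\<^sup>)\<close> in layer \<open>1\<close>.\<close>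

lemma gr_mult_Z2_set_inv:
  assumes G: "comm_group G" and T: "T \<subseteq> carrier G" and z: "z \<in> carrier G"
  defines "I \<equiv> indicator T :: _ \<Rightarrow> int"
  defines "I' \<equiv> indicator (Z2_set T (set_inv\<^bsub>G\<^esub> T)) :: _ \<Rightarrow> int"
  shows "gr_mult (Z2 \<times>\<times> G) I' (gr_inv (Z2 \<times>\<times> G) I') (0, z) = 2 * gr_mult G I (gr_inv G I) z"
    and "gr_mult (Z2 \<times>\<times> G) I' (gr_inv (Z2 \<times>\<times> G) I') (1, z) =
           gr_mult G I I z + gr_mult G (gr_inv G I) (gr_inv G I) z"
proof -
  interpret G: comm_group G by fact
  interpret Z: group "Z2 \<times>\<times> G" using DirProd_group[OF group_integer_mod_group G.is_group] .
  have I'0: "I' (0, x) = I x" for x by (simp add: I_def I'_def indicator_def mem_Z2_set)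
  have I'1: "I' (1, x) = gr_inv G I x" if "x \<in> carrier G" for x
    using that T by (simp add: I_def I'_def gr_inv_def indicator_def mem_Z2_set G.mem_set_inv_iff)
  have inv: "gr_inv (Z2 \<times>\<times> G) I' (a, x) = I' (a, inv\<^bsub>G\<^esub> x)" if "a \<in> {0, 1}" "x \<in> carrier G" for a x
    using that by (auto simp: gr_inv_def inv_DirProd[OF group_integer_mod_group G.is_group] carrier_Z2)
  have inv0: "gr_inv (Z2 \<times>\<times> G) I' (0, x) = gr_inv G I x" if "x \<in> carrier G" for x
    using that inv[of 0 x] I'0 by (simp add: gr_inv_def)
  have inv1: "gr_inv (Z2 \<times>\<times> G) I' (1, x) = I x" if "x \<in> carrier G" for x
    using that inv[of 1 x] I'1[of "inv\<^bsub>G\<^esub> x"] by (simp add: gr_inv_def)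
  have expand: "gr_mult (Z2 \<times>\<times> G) I' (gr_inv (Z2 \<times>\<times> G) I') (c, z) =
      (\<Sum>a\<in>{0, 1}. \<Sum>x\<in>carrier G.
        I' (a, x) * gr_inv (Z2 \<times>\<times> G) I' ((c - a) mod 2, inv\<^bsub>G\<^esub> x \<otimes>\<^bsub>G\<^esub> z))" if "c \<in> {0, 1}" for c
    unfolding sum.cartesian_product
    using that z
    by (subst Z.gr_mult_eq)
       (auto simp: carrier_Z2 inv_DirProd[OF group_integer_mod_group G.is_group] intro!: sum.cong)
  have "gr_mult (Z2 \<times>\<times> G) I' (gr_inv (Z2 \<times>\<times> G) I') (0, z) =
      gr_mult G I (gr_inv G I) z + gr_mult G (gr_inv G I) I z"
    using z by (simp add: expand G.gr_mult_eq I'0 I'1 inv0 inv1)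
  then show "gr_mult (Z2 \<times>\<times> G) I' (gr_inv (Z2 \<times>\<times> G) I') (0, z) = 2 * gr_mult G I (gr_inv G I) z"
    using G.gr_mult_commute[of "gr_inv G I" I] by simp
  show "gr_mult (Z2 \<times>\<times> G) I' (gr_inv (Z2 \<times>\<times> G) I') (1, z) =
      gr_mult G I I z + gr_mult G (gr_inv G I) (gr_inv G I) z"
    using z by (simp add: expand G.gr_mult_eq I'0 I'1 inv0 inv1)
qed

section \<open>Combining two formally dual pairs\<close>

lemma set_inv_Times:
  assumes "group G" and "group H" and "T \<subseteq> carrier G" and "U \<subseteq> carrier H"
  shows "set_inv\<^bsub>G \<times>\<times> H\<^esub> (T \<times> U) = (set_inv\<^bsub>G\<^esub> T) \<times> (set_inv\<^bsub>H\<^esub> U)"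
  using assms(3,4) inv_DirProd[OF assms(1,2)] by (fastforce simp: SET_INV_def subset_iff)

lemma gr_mult_Z2_set_Times_inv:
  assumes G: "comm_group G" and H: "comm_group H"
    and T: "T \<subseteq> carrier G" and U: "U \<subseteq> carrier H" and y: "y \<in> carrier G" and z: "z \<in> carrier H"
  defines "I \<equiv> indicator T :: _ \<Rightarrow> int" and "J \<equiv> indicator U :: _ \<Rightarrow> int"
  defines "W \<equiv> Z2 \<times>\<times> G \<times>\<times> H"
  defines "L \<equiv> indicator (Z2_set (T \<times> U) ((set_inv\<^bsub>G\<^esub> T) \<times> (set_inv\<^bsub>H\<^esub> U))) :: _ \<Rightarrow> int"
  shows "gr_mult W L (gr_inv W L) (0, y, z) = 2 * (gr_mult G I (gr_inv G I) y * gr_mult H J (gr_inv H J) z)"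
    and "gr_mult W L (gr_inv W L) (1, y, z) = gr_mult G I I y * gr_mult H J J z +
      gr_mult G (gr_inv G I) (gr_inv G I) y * gr_mult H (gr_inv H J) (gr_inv H J) z"
proof -
  interpret G: comm_group G by fact
  interpret H: comm_group H by fact
  have GH: "comm_group (G \<times>\<times> H)" using DirProd_comm_group G H .
  let ?F = "indicator (T \<times> U) :: _ \<Rightarrow> int"
  have L: "L = indicator (Z2_set (T \<times> U) (set_inv\<^bsub>G \<times>\<times> H\<^esub> (T \<times> U)))"
    by (simp add: L_def set_inv_Times[OF G.is_group H.is_group T U])
  have TU: "T \<times> U \<subseteq> carrier (G \<times>\<times> H)" and yz: "(y, z) \<in> carrier (G \<times>\<times> H)"
    using T U y z by auto
  have F: "?F (x, w) = I x * J w" for x w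
    by (simp add: I_def J_def indicator_def)
  have Fi: "gr_inv (G \<times>\<times> H) ?F (x, w) = gr_inv G I x * gr_inv H J w"
    if "x \<in> carrier G" "w \<in> carrier H" for x w
    using that by (simp add: gr_inv_def inv_DirProd[OF G.is_group H.is_group] F)
  note times = gr_mult_Times[OF G.is_group H.is_group y z]
  show "gr_mult W L (gr_inv W L) (0, y, z) = 2 * (gr_mult G I (gr_inv G I) y * gr_mult H J (gr_inv H J) z)"
    unfolding L W_def gr_mult_Z2_set_inv(1)[OF GH TU yz]
    by (simp only: times[of ?F I J "gr_inv (G \<times>\<times> H) ?F" "gr_inv G I" "gr_inv H J", OF F Fi])
  show "gr_mult W L (gr_inv W L) (1, y, z) = gr_mult G I I y * gr_mult H J J z +
      gr_mult G (gr_inv G I) (gr_inv G I) y * gr_mult H (gr_inv H J) (gr_inv H J) z"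
    unfolding L W_def gr_mult_Z2_set_inv(2)[OF GH TU yz]
    by (simp only: times[of ?F I J ?F I J, OF F F] times[of "gr_inv (G \<times>\<times> H) ?F" "gr_inv G I"
          "gr_inv H J" "gr_inv (G \<times>\<times> H) ?F" "gr_inv G I" "gr_inv H J", OF Fi Fi])
qed

text \<open>The defining equation of a dual pair in \<open>Z2 \<times>\<times> G\<close>, at an element of the form \<open>(1, z)\<close>.\<close>

lemma formally_dual_pair_Z2_odd_value:
  assumes G: "comm_group G" "finite (carrier G)"
    and dual: "formally_dual_pair (Z2 \<times>\<times> G) (Z2_prod_iso G \<Delta>) (Z2_set A0 A1)
      (Z2_set T (set_inv\<^bsub>G\<^esub> T))"
    and disj: "A0 \<inter> A1 = {}" and T: "T \<subseteq> carrier G" and A: "A0 \<union> A1 \<subseteq> carrier G"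
    and z: "z \<in> carrier G"
  defines "I \<equiv> indicator T :: _ \<Rightarrow> int"
  shows "(cmod (gr_eval G (\<Delta> z) (indicator A0) - gr_eval G (\<Delta> z) (indicator A1)))\<^sup>2 =
    (real (card (A0 \<union> A1)))\<^sup>2 / (2 * real (card T)) *
      real_of_int (gr_mult G I I z + gr_mult G (gr_inv G I) (gr_inv G I) z)"
proof -
  interpret G: comm_group G by fact
  interpret Z: group "Z2 \<times>\<times> G" using DirProd_group[OF group_integer_mod_group G.is_group] .
  let ?T' = "Z2_set T (set_inv\<^bsub>G\<^esub> T)"
  have fin: "finite T" "finite (set_inv\<^bsub>G\<^esub> T)" "finite A0" "finite A1"
    using G(2) T A G.set_inv_closed[OF T] by (auto dest: finite_subset)
  have cT: "card ?T' = 2 * card T"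
    using fin by (simp add: card_Z2_set G.card_set_inv[OF T])
  have cA: "card (Z2_set A0 A1) = card (A0 \<union> A1)"
    using fin disj by (simp add: card_Z2_set card_Un_disjoint)
  have T': "?T' \<subseteq> carrier (Z2 \<times>\<times> G)"
    using T G.set_inv_closed[OF T] by (rule Z2_set_closed)
  have z1: "(1, z) \<in> carrier (Z2 \<times>\<times> G)" using z by (simp add: carrier_Z2)
  have "int (nu (Z2 \<times>\<times> G) ?T' (1, z)) =
      gr_mult G I I z + gr_mult G (gr_inv G I) (gr_inv G I) z"
    using G(2) unfolding I_def gr_mult_Z2_set_inv(2)[OF G(1) T z, symmetric]
    by (intro Z.nu_eq_gr_mult T' z1) (simp add: carrier_Z2)
  then have nu: "real (nu (Z2 \<times>\<times> G) ?T' (1, z)) =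
      real_of_int (gr_mult G I I z + gr_mult G (gr_inv G I) (gr_inv G I) z)"
    by (metis of_int_of_nat_eq)
  have "(cmod (gr_eval (Z2 \<times>\<times> G) (Z2_prod_iso G \<Delta> (1, z)) (indicator (Z2_set A0 A1))))\<^sup>2 =
      (real (card (Z2_set A0 A1)))\<^sup>2 / real (card ?T') * real (nu (Z2 \<times>\<times> G) ?T' (1, z))"
    using dual z1 unfolding formally_dual_pair_def by blast
  then show ?thesis
    by (simp add: gr_eval_Z2_set nu cT cA)
qed

text \<open>Where the \<open>Z2\<close>-component is \<open>0\<close>, the defining equation for the product pair holds
  automatically. Where it is \<open>1\<close>, with \<open>p, q\<close> and \<open>p', q'\<close> the coefficients of \<open>TT\<close> and
  \<open>T\<^sup>(\<^sup>-\<^sup>1\<^sup>)T\<^sup>(\<^sup>-\<^sup>1\<^sup>)\<close> for the two factors, it says \<open>(p + q)(p' + q') = 2(pp' + qq')\<close>, that is,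
  \<open>(p - q)(p' - q') = 0\<close>.\<close>

lemma formally_dual_pair_twisted_Times_iff:
  assumes G: "comm_group G" "finite (carrier G)" and H: "comm_group H" "finite (carrier H)"
    and A: "formally_dual_pair G \<Delta> (A0 \<union> A1) T" "A0 \<inter> A1 = {}"
    and B: "formally_dual_pair H \<Gamma> (B0 \<union> B1) U" "B0 \<inter> B1 = {}"
    and A': "formally_dual_pair (Z2 \<times>\<times> G) (Z2_prod_iso G \<Delta>) (Z2_set A0 A1)
      (Z2_set T (set_inv\<^bsub>G\<^esub> T))"
    and B': "formally_dual_pair (Z2 \<times>\<times> H) (Z2_prod_iso H \<Gamma>) (Z2_set B0 B1)
      (Z2_set U (set_inv\<^bsub>H\<^esub> U))"
  defines "I \<equiv> indicator T :: _ \<Rightarrow> int" and "J \<equiv> indicator U :: _ \<Rightarrow> int"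
  shows "formally_dual_pair (Z2 \<times>\<times> G \<times>\<times> H) (Z2_prod_iso (G \<times>\<times> H) (prod_iso G H \<Delta> \<Gamma>))
      (Z2_set (A0 \<times> B0 \<union> A1 \<times> B1) (A0 \<times> B1 \<union> A1 \<times> B0))
      (Z2_set (T \<times> U) ((set_inv\<^bsub>G\<^esub> T) \<times> (set_inv\<^bsub>H\<^esub> U))) \<longleftrightarrow>
    (\<forall>y\<in>carrier G. \<forall>z\<in>carrier H.
      gr_mult G I I y = gr_mult G (gr_inv G I) (gr_inv G I) y \<or>
      gr_mult H J J z = gr_mult H (gr_inv H J) (gr_inv H J) z)"
proof -
  interpret G: comm_group G by fact
  interpret H: comm_group H by fact
  interpret GH: comm_group "G \<times>\<times> H" using DirProd_comm_group G(1) H(1) .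
  interpret W: comm_group "Z2 \<times>\<times> G \<times>\<times> H"
    using DirProd_comm_group[OF abelian_integer_mod_group GH.comm_group_axioms] .
  let ?W = "Z2 \<times>\<times> G \<times>\<times> H" and ?\<Theta> = "Z2_prod_iso (G \<times>\<times> H) (prod_iso G H \<Delta> \<Gamma>)"
  let ?Ti = "set_inv\<^bsub>G\<^esub> T" and ?Ui = "set_inv\<^bsub>H\<^esub> U"
  let ?S = "Z2_set (A0 \<times> B0 \<union> A1 \<times> B1) (A0 \<times> B1 \<union> A1 \<times> B0)"
  let ?T = "Z2_set (T \<times> U) (?Ti \<times> ?Ui)"
  let ?P = "gr_mult G I I" and ?Q = "gr_mult G (gr_inv G I) (gr_inv G I)"
  let ?P' = "gr_mult H J J" and ?Q' = "gr_mult H (gr_inv H J) (gr_inv H J)"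
  let ?N = "gr_mult G I (gr_inv G I)" and ?N' = "gr_mult H J (gr_inv H J)"
  define a b t u where "a = real (card (A0 \<union> A1))" and "b = real (card (B0 \<union> B1))"
    and "t = real (card T)" and "u = real (card U)"
  from A B have iso: "\<Delta> \<in> iso G (dual_group G)" "\<Gamma> \<in> iso H (dual_group H)"
    and sub: "A0 \<union> A1 \<subseteq> carrier G" "B0 \<union> B1 \<subseteq> carrier H" "T \<subseteq> carrier G" "U \<subseteq> carrier H"
    and ne: "A0 \<union> A1 \<noteq> {}" "B0 \<union> B1 \<noteq> {}" "T \<noteq> {}" "U \<noteq> {}"
    unfolding formally_dual_pair_def by blast+
  have fin: "finite A0" "finite A1" "finite B0" "finite B1" "finite T" "finite U"
      "finite ?Ti" "finite ?Ui"
    using sub G(2) H(2) G.set_inv_closed[OF sub(3)] H.set_inv_closed[OF sub(4)]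
    by (auto dest: finite_subset)
  have pos: "a > 0" "b > 0" "t > 0" "u > 0"
    using ne fin by (auto simp: a_def b_def t_def u_def card_gt_0_iff)
  have ST: "?S \<subseteq> carrier ?W" "?T \<subseteq> carrier ?W"
    using sub G.set_inv_closed[OF sub(3)] H.set_inv_closed[OF sub(4)]
    by (auto simp: mem_Z2_set carrier_Z2)
  have ST_ne: "?S \<noteq> {}" "?T \<noteq> {}"
    using ne by (auto simp: mem_Z2_set ex_in_conv[symmetric])
  have isoW: "?\<Theta> \<in> iso ?W (dual_group ?W)"
    by (intro Z2_prod_iso_iso prod_iso_iso iso GH.is_group G.is_group H.is_group)
  have cT: "real (card ?T) = 2 * t * u"
    using fin by (simp add: card_Z2_set card_cartesian_product G.card_set_inv[OF sub(3)]
        H.card_set_inv[OF sub(4)] t_def u_def)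
  have "card ?S = (card A0 * card B0 + card A1 * card B1) + (card A0 * card B1 + card A1 * card B0)"
    using fin A(2)
    by (simp add: card_Z2_set card_Un_disjoint card_cartesian_product Times_Int_Times)
  also have "\<dots> = card (A0 \<union> A1) * card (B0 \<union> B1)"
    using fin A(2) B(2) by (simp add: card_Un_disjoint algebra_simps)
  finally have cS: "real (card ?S) = a * b" by (simp add: a_def b_def)
  define E0 E1 F0 F1 where "E0 y = gr_eval G (\<Delta> y) (indicator A0)"
    and "E1 y = gr_eval G (\<Delta> y) (indicator A1)"
    and "F0 z = gr_eval H (\<Gamma> z) (indicator B0)"
    and "F1 z = gr_eval H (\<Gamma> z) (indicator B1)" for y z
  have "(A0 \<times> B0) \<inter> (A1 \<times> B1) = {}" "(A0 \<times> B1) \<inter> (A1 \<times> B0) = {}" using A(2) by auto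
  note S_layers = this[THEN gr_eval_Un]
  have eval: "gr_eval ?W (?\<Theta> (w, y, z)) (indicator ?S) =
      (E0 y * F0 z + E1 y * F1 z) + (-1) powi w * (E0 y * F1 z + E1 y * F0 z)" for w y z
    by (simp only: gr_eval_Z2_set S_layers gr_eval_prod_iso E0_def E1_def F0_def F1_def)
  have eval0: "gr_eval ?W (?\<Theta> (0, y, z)) (indicator ?S) = (E0 y + E1 y) * (F0 z + F1 z)" for y z
    unfolding eval by (simp add: algebra_simps)
  have eval1: "gr_eval ?W (?\<Theta> (1, y, z)) (indicator ?S) = (E0 y - E1 y) * (F0 z - F1 z)" for y z
    unfolding eval by (simp add: algebra_simps)
  have nuW: "real (nu ?W ?T (w, y, z)) =
      real_of_int (gr_mult ?W (indicator ?T) (gr_inv ?W (indicator ?T)) (w, y, z))"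
    if "w \<in> {0, 1}" "y \<in> carrier G" "z \<in> carrier H" for w y z
    using W.nu_eq_gr_mult[of ?T "(w, y, z)"] ST G(2) H(2) that
    by (simp add: carrier_Z2)
  have at0: "(cmod (gr_eval ?W (?\<Theta> (0, y, z)) (indicator ?S)))\<^sup>2 =
      (real (card ?S))\<^sup>2 / real (card ?T) * real (nu ?W ?T (0, y, z))"
    if y: "y \<in> carrier G" and z: "z \<in> carrier H" for y z
  proof -
    have "(cmod (E0 y + E1 y))\<^sup>2 = a\<^sup>2 / t * real (nu G T y)"
      using A(1) y by (simp add: formally_dual_pair_def E0_def E1_def a_def t_def
          gr_eval_Un[OF A(2), symmetric])
    moreover have "real (nu G T y) = real_of_int (?N y)"
      using G.nu_eq_gr_mult[OF G(2) sub(3) y] unfolding I_def by (metis of_int_of_nat_eq)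
    moreover have "(cmod (F0 z + F1 z))\<^sup>2 = b\<^sup>2 / u * real (nu H U z)"
      using B(1) z by (simp add: formally_dual_pair_def F0_def F1_def b_def u_def
          gr_eval_Un[OF B(2), symmetric])
    moreover have "real (nu H U z) = real_of_int (?N' z)"
      using H.nu_eq_gr_mult[OF H(2) sub(4) z] unfolding J_def by (metis of_int_of_nat_eq)
    moreover have "real (nu ?W ?T (0, y, z)) = 2 * (real_of_int (?N y) * real_of_int (?N' z))"
      using nuW[of 0 y z] y z gr_mult_Z2_set_Times_inv(1)[OF G(1) H(1) sub(3,4) y z] by (simp add: I_def J_def)
    ultimately show ?thesis
      unfolding eval0 norm_mult power_mult_distrib cS cT by (simp add: field_simps)
  qed
  have at1: "(cmod (gr_eval ?W (?\<Theta> (1, y, z)) (indicator ?S)))\<^sup>2 =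
      (real (card ?S))\<^sup>2 / real (card ?T) * real (nu ?W ?T (1, y, z)) \<longleftrightarrow>
      ?P y = ?Q y \<or> ?P' z = ?Q' z"
    if y: "y \<in> carrier G" and z: "z \<in> carrier H" for y z
  proof -
    define p q p' q' where "p = real_of_int (?P y)" and "q = real_of_int (?Q y)"
      and "p' = real_of_int (?P' z)" and "q' = real_of_int (?Q' z)"
    have e: "(cmod (E0 y - E1 y))\<^sup>2 = a\<^sup>2 / (2 * t) * (p + q)"
      using formally_dual_pair_Z2_odd_value[OF G A' A(2) sub(3,1) y]
      by (simp add: E0_def E1_def a_def t_def p_def q_def I_def)
    have f: "(cmod (F0 z - F1 z))\<^sup>2 = b\<^sup>2 / (2 * u) * (p' + q')"
      using formally_dual_pair_Z2_odd_value[OF H B' B(2) sub(4,2) z]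
      by (simp add: F0_def F1_def b_def u_def p'_def q'_def J_def)
    have n: "real (nu ?W ?T (1, y, z)) = p * p' + q * q'"
      using nuW[of 1 y z] y z gr_mult_Z2_set_Times_inv(2)[OF G(1) H(1) sub(3,4) y z]
      by (simp add: I_def J_def p_def q_def p'_def q'_def)
    have "(cmod (gr_eval ?W (?\<Theta> (1, y, z)) (indicator ?S)))\<^sup>2 -
        (real (card ?S))\<^sup>2 / real (card ?T) * real (nu ?W ?T (1, y, z)) =
        (a * b)\<^sup>2 / (4 * t * u) * ((p + q) * (p' + q') - 2 * (p * p' + q * q'))"
      unfolding eval1 norm_mult power_mult_distrib e f n cS cT using pos by (simp add: field_simps)
    also have "(p + q) * (p' + q') - 2 * (p * p' + q * q') = - ((p - q) * (p' - q'))"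
      by (simp add: algebra_simps)
    finally have "(cmod (gr_eval ?W (?\<Theta> (1, y, z)) (indicator ?S)))\<^sup>2 =
        (real (card ?S))\<^sup>2 / real (card ?T) * real (nu ?W ?T (1, y, z)) \<longleftrightarrow>
        (a * b)\<^sup>2 / (4 * t * u) * - ((p - q) * (p' - q')) = 0"
      by linarith
    also have "\<dots> \<longleftrightarrow> p = q \<or> p' = q'" using pos by simp
    finally show ?thesis by (simp add: p_def q_def p'_def q'_def)
  qed
  have "formally_dual_pair ?W ?\<Theta> ?S ?T \<longleftrightarrow> (\<forall>y\<in>carrier G. \<forall>z\<in>carrier H. \<forall>w\<in>{0, 1}.
      (cmod (gr_eval ?W (?\<Theta> (w, y, z)) (indicator ?S)))\<^sup>2 =
      (real (card ?S))\<^sup>2 / real (card ?T) * real (nu ?W ?T (w, y, z)))"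
    unfolding formally_dual_pair_def using isoW ST ST_ne by (auto simp: carrier_Z2)
  also have "\<dots> \<longleftrightarrow> (\<forall>y\<in>carrier G. \<forall>z\<in>carrier H. ?P y = ?Q y \<or> ?P' z = ?Q' z)"
    using at0 at1 by blast
  finally show ?thesis .
qed

text \<open>In the product of the set with its inverse, the support of layer \<open>0\<close> is always a product set.
  If the support of layer \<open>1\<close> is also a product set \<open>R \<times> R'\<close>, then \<open>\<theta>\<close> is the number of elements outside these two sets.\<close>

lemma theta_Z2_set_Times_inv:
  assumes G: "comm_group G" "finite (carrier G)" and H: "comm_group H" "finite (carrier H)"
    and T: "T \<subseteq> carrier G" and U: "U \<subseteq> carrier H"
    and R: "R \<subseteq> carrier G" "R' \<subseteq> carrier H"
  defines "I \<equiv> indicator T :: _ \<Rightarrow> int" and "J \<equiv> indicator U :: _ \<Rightarrow> int"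
  assumes supp: "\<And>y z. y \<in> carrier G \<Longrightarrow> z \<in> carrier H \<Longrightarrow>
    gr_mult G I I y * gr_mult H J J z +
      gr_mult G (gr_inv G I) (gr_inv G I) y * gr_mult H (gr_inv H J) (gr_inv H J) z = 0 \<longleftrightarrow>
    \<not> (y \<in> R \<and> z \<in> R')"
  shows "int (theta (Z2_set (T \<times> U) ((set_inv\<^bsub>G\<^esub> T) \<times> (set_inv\<^bsub>H\<^esub> U))) (Z2 \<times>\<times> G \<times>\<times> H)) =
    2 * int (order G) * int (order H)
    - int (card (gr_supp G (gr_mult G I (gr_inv G I)))) * int (card (gr_supp H (gr_mult H J (gr_inv H J))))
    - int (card R) * int (card R')"
proof -
  let ?W = "Z2 \<times>\<times> G \<times>\<times> H"
  let ?L = "indicator (Z2_set (T \<times> U) ((set_inv\<^bsub>G\<^esub> T) \<times> (set_inv\<^bsub>H\<^esub> U))) :: _ \<Rightarrow> int"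
  let ?N = "gr_supp G (gr_mult G I (gr_inv G I))" and ?N' = "gr_supp H (gr_mult H J (gr_inv H J))"
  let ?X = "({0::int} \<times> ?N \<times> ?N') \<union> ({1} \<times> R \<times> R')"
  note coeff = gr_mult_Z2_set_Times_inv[OF G(1) H(1) T U, folded I_def J_def]
  have nonneg: "gr_mult G I (gr_inv G I) y \<ge> 0" "gr_mult H J (gr_inv H J) z \<ge> 0" for y z
    by (auto intro!: gr_mult_nonneg simp: I_def J_def gr_inv_def indicator_def)
  have zero: "gr_mult G I (gr_inv G I) y = 0 \<longleftrightarrow> \<not> gr_mult G I (gr_inv G I) y > 0"
    "gr_mult H J (gr_inv H J) z = 0 \<longleftrightarrow> \<not> gr_mult H J (gr_inv H J) z > 0" for y z
    using nonneg(1)[of y] nonneg(2)[of z] by linarith+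
  have N: "?N \<subseteq> carrier G" "?N' \<subseteq> carrier H" by (auto simp: gr_supp_def)
  have fin: "finite ?N" "finite ?N'" "finite R" "finite R'"
    using N R G(2) H(2) by (auto dest: finite_subset)
  have "{g \<in> carrier ?W. gr_mult ?W ?L (gr_inv ?W ?L) g = 0} = carrier ?W - ?X"
    by (auto simp: carrier_Z2 coeff supp gr_supp_def zero)
  then have "theta (Z2_set (T \<times> U) ((set_inv\<^bsub>G\<^esub> T) \<times> (set_inv\<^bsub>H\<^esub> U))) ?W = card (carrier ?W - ?X)"
    by (simp only: theta_def)
  also have "int \<dots> = int (card (carrier ?W)) - int (card ?X)"
  proof -
    have sub: "?X \<subseteq> carrier ?W" using N R by (auto simp: carrier_Z2)
    have finW: "finite (carrier ?W)" using G H by (simp add: carrier_Z2)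
    show ?thesis
      using sub finW by (simp only: card_Diff_subset[OF finite_subset[OF sub finW] sub]
          of_nat_diff[OF card_mono[OF finW sub]])
  qed
  also have "card ?X = card ?N * card ?N' + card R * card R'"
    using fin by (subst card_Un_disjoint) (auto simp: card_cartesian_product)
  also have "card (carrier ?W) = 2 * order G * order H"
    by (simp add: carrier_Z2 order_def card_cartesian_product)
  finally show ?thesis by simp
qed

theorem theorem5p1:
  fixes G1 :: "('a, 'm) monoid_scheme" and G2 :: "('b, 'n) monoid_scheme"
    and \<Delta>1 :: "'a \<Rightarrow> 'a \<Rightarrow> complex" and \<Delta>2 :: "'b \<Rightarrow> 'b \<Rightarrow> complex"
    and S1 T1 S10 S11 :: "'a set" and S2 T2 S20 S21 :: "'b set"
    and S0'' S1'' :: "('a \<times> 'b) set" and S'' T'' :: "(int \<times> 'a \<times> 'b) set"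
  assumes "comm_group G1" and "finite (carrier G1)"
    and "comm_group G2" and "finite (carrier G2)"
    and "primitive_formally_dual_pair G1 \<Delta>1 S1 T1"
    and "primitive_formally_dual_pair G2 \<Delta>2 S2 T2"
    and "S1 = S10 \<union> S11" and "S10 \<inter> S11 = {}"
    and "S2 = S20 \<union> S21" and "S20 \<inter> S21 = {}"
    and "primitive_formally_dual_pair (Z2 \<times>\<times> G1) (Z2_prod_iso G1 \<Delta>1)
           (Z2_set S10 S11) (Z2_set T1 (set_inv\<^bsub>G1\<^esub> T1))"
    and "primitive_formally_dual_pair (Z2 \<times>\<times> G2) (Z2_prod_iso G2 \<Delta>2)
           (Z2_set S20 S21) (Z2_set T2 (set_inv\<^bsub>G2\<^esub> T2))"
    and "S0'' = (S10 \<times> S20) \<union> (S11 \<times> S21)"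
    and "S1'' = (S10 \<times> S21) \<union> (S11 \<times> S20)"
    and "S'' = Z2_set S0'' S1''"
    and "T'' = Z2_set (T1 \<times> T2) ((set_inv\<^bsub>G1\<^esub> T1) \<times> (set_inv\<^bsub>G2\<^esub> T2))"
  shows "(primitive_formally_dual_pair (Z2 \<times>\<times> G1 \<times>\<times> G2)
           (Z2_prod_iso (G1 \<times>\<times> G2) (prod_iso G1 G2 \<Delta>1 \<Delta>2)) S'' T'' \<longleftrightarrow>
         (\<forall>\<chi>\<in>carrier (dual_group G1). (gr_eval G1 \<chi> (indicator T1))\<^sup>2 \<in> \<real>) \<or>
         (\<forall>\<chi>\<in>carrier (dual_group G2). (gr_eval G2 \<chi> (indicator T2))\<^sup>2 \<in> \<real>)) \<and>
         ((\<forall>\<chi>\<in>carrier (dual_group G2). (gr_eval G2 \<chi> (indicator T2))\<^sup>2 \<in> \<real>) \<longrightarrow>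
         int (theta T'' (Z2 \<times>\<times> G1 \<times>\<times> G2)) =
           2 * int (order G1) * int (order G2)
           - int (card (gr_supp G1 (gr_mult G1 (indicator T1) (gr_inv G1 (indicator T1)))))
             * int (card (gr_supp G2 (gr_mult G2 (indicator T2) (gr_inv G2 (indicator T2)))))
           - int (card (gr_supp G1 (gr_add (gr_mult G1 (indicator T1) (indicator T1))
                 (gr_mult G1 (gr_inv G1 (indicator T1)) (gr_inv G1 (indicator T1))))))
             * int (card (gr_supp G2 (gr_mult G2 (indicator T2) (indicator T2))))) \<and>
         ((\<forall>\<chi>\<in>carrier (dual_group G1). (gr_eval G1 \<chi> (indicator T1))\<^sup>2 \<in> \<real>) \<longrightarrow>
         int (theta T'' (Z2 \<times>\<times> G1 \<times>\<times> G2)) =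
           2 * int (order G1) * int (order G2)
           - int (card (gr_supp G1 (gr_mult G1 (indicator T1) (gr_inv G1 (indicator T1)))))
             * int (card (gr_supp G2 (gr_mult G2 (indicator T2) (gr_inv G2 (indicator T2)))))
           - int (card (gr_supp G1 (gr_mult G1 (indicator T1) (indicator T1))))
             * int (card (gr_supp G2 (gr_add (gr_mult G2 (indicator T2) (indicator T2))
                 (gr_mult G2 (gr_inv G2 (indicator T2)) (gr_inv G2 (indicator T2)))))))"
proof -
  note G1 = assms(1,2) and G2 = assms(3,4)
  interpret G1: comm_group G1 by fact
  interpret G2: comm_group G2 by fact
  have dual: "formally_dual_pair G1 \<Delta>1 (S10 \<union> S11) T1" "formally_dual_pair G2 \<Delta>2 (S20 \<union> S21) T2"
    and prim: "primitive_subset G1 (S10 \<union> S11)" "primitive_subset G1 T1"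
      "primitive_subset G2 (S20 \<union> S21)" "primitive_subset G2 T2"
    and dual': "formally_dual_pair (Z2 \<times>\<times> G1) (Z2_prod_iso G1 \<Delta>1)
        (Z2_set S10 S11) (Z2_set T1 (set_inv\<^bsub>G1\<^esub> T1))"
      "formally_dual_pair (Z2 \<times>\<times> G2) (Z2_prod_iso G2 \<Delta>2)
        (Z2_set S20 S21) (Z2_set T2 (set_inv\<^bsub>G2\<^esub> T2))"
    and prim': "primitive_subset (Z2 \<times>\<times> G1) (Z2_set S10 S11)"
      "primitive_subset (Z2 \<times>\<times> G1) (Z2_set T1 (set_inv\<^bsub>G1\<^esub> T1))"
      "primitive_subset (Z2 \<times>\<times> G2) (Z2_set S20 S21)"
    using assms(5-7,9,11,12) by (simp_all add: primitive_formally_dual_pair_def)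
  from dual have iso: "\<Delta>1 \<in> iso G1 (dual_group G1)" "\<Delta>2 \<in> iso G2 (dual_group G2)"
    and ne: "S10 \<union> S11 \<noteq> {}" "T1 \<noteq> {}" "S20 \<union> S21 \<noteq> {}" "T2 \<noteq> {}"
    and T: "T1 \<subseteq> carrier G1" "T2 \<subseteq> carrier G2"
    unfolding formally_dual_pair_def by blast+
  have S''_eq: "S'' = Z2_set (S10 \<times> S20 \<union> S11 \<times> S21) (S10 \<times> S21 \<union> S11 \<times> S20)"
    using assms(13-15) by simp
  note T''_eq = assms(16)
  let ?I = "indicator T1 :: 'a \<Rightarrow> int" and ?J = "indicator T2 :: 'b \<Rightarrow> int"
  let ?P = "gr_mult G1 ?I ?I" and ?Q = "gr_mult G1 (gr_inv G1 ?I) (gr_inv G1 ?I)"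
  let ?P' = "gr_mult G2 ?J ?J" and ?Q' = "gr_mult G2 (gr_inv G2 ?J) (gr_inv G2 ?J)"
  note real1 = G1.gr_eval_square_real_iff[OF G1(2) iso(1), of ?I]
  note real2 = G2.gr_eval_square_real_iff[OF G2(2) iso(2), of ?J]
  have "primitive_subset (Z2 \<times>\<times> G1 \<times>\<times> G2) S''"
    unfolding S''_eq
    using primitive_subset_Z2_set_twisted_Times[OF G1 G2 prim(1) ne(1) assms(8) prim(3) ne(3) assms(10) prim'(1,3)] .
  moreover have "primitive_subset (Z2 \<times>\<times> G1 \<times>\<times> G2) T''"
    unfolding T''_eq
    using primitive_subset_Z2_set_Times_inv[OF G1 G2 prim(2) ne(2) prim(4) ne(4) prim'(2)] .
  moreover have "formally_dual_pair (Z2 \<times>\<times> G1 \<times>\<times> G2)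
      (Z2_prod_iso (G1 \<times>\<times> G2) (prod_iso G1 G2 \<Delta>1 \<Delta>2)) S'' T'' \<longleftrightarrow>
      (\<forall>y\<in>carrier G1. \<forall>z\<in>carrier G2. ?P y = ?Q y \<or> ?P' z = ?Q' z)"
    unfolding S''_eq T''_eq
    by (rule formally_dual_pair_twisted_Times_iff[OF G1 G2 dual(1) assms(8) dual(2) assms(10) dual'])
  ultimately have iff: "primitive_formally_dual_pair (Z2 \<times>\<times> G1 \<times>\<times> G2)
      (Z2_prod_iso (G1 \<times>\<times> G2) (prod_iso G1 G2 \<Delta>1 \<Delta>2)) S'' T'' \<longleftrightarrow>
      (\<forall>y\<in>carrier G1. ?P y = ?Q y) \<or> (\<forall>z\<in>carrier G2. ?P' z = ?Q' z)"
    unfolding primitive_formally_dual_pair_def by blast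
  have nonneg: "?P y \<ge> 0" "?Q y \<ge> 0" "?P' z \<ge> 0" "?Q' z \<ge> 0" for y z
    by (auto intro!: gr_mult_nonneg simp: gr_inv_def indicator_def)
  have split: "(m + n) * k = 0 \<longleftrightarrow> \<not> (0 < m + n \<and> 0 < k)"
    if "m \<ge> 0" "n \<ge> 0" "k \<ge> 0" for m n k :: int
    using that by auto
  have theta2: "int (theta T'' (Z2 \<times>\<times> G1 \<times>\<times> G2)) =
      2 * int (order G1) * int (order G2)
      - int (card (gr_supp G1 (gr_mult G1 ?I (gr_inv G1 ?I))))
        * int (card (gr_supp G2 (gr_mult G2 ?J (gr_inv G2 ?J))))
      - int (card (gr_supp G1 (gr_add ?P ?Q))) * int (card (gr_supp G2 ?P'))"
    if eq: "\<forall>z\<in>carrier G2. ?P' z = ?Q' z"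
    unfolding T''_eq
  proof (rule theta_Z2_set_Times_inv[OF G1 G2 T])
    fix y z assume y: "y \<in> carrier G1" and z: "z \<in> carrier G2"
    have "?P y * ?P' z + ?Q y * ?Q' z = (?P y + ?Q y) * ?P' z"
      using eq z by (simp add: distrib_right)
    then show "?P y * ?P' z + ?Q y * ?Q' z = 0 \<longleftrightarrow>
        \<not> (y \<in> gr_supp G1 (gr_add ?P ?Q) \<and> z \<in> gr_supp G2 ?P')"
      using split[OF nonneg(1,2,3), of y y z] y z by (simp add: gr_supp_def gr_add_def)
  qed (auto simp: gr_supp_def)
  have theta1: "int (theta T'' (Z2 \<times>\<times> G1 \<times>\<times> G2)) =
      2 * int (order G1) * int (order G2)
      - int (card (gr_supp G1 (gr_mult G1 ?I (gr_inv G1 ?I))))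
        * int (card (gr_supp G2 (gr_mult G2 ?J (gr_inv G2 ?J))))
      - int (card (gr_supp G1 ?P)) * int (card (gr_supp G2 (gr_add ?P' ?Q')))"
    if eq: "\<forall>y\<in>carrier G1. ?P y = ?Q y"
    unfolding T''_eq
  proof (rule theta_Z2_set_Times_inv[OF G1 G2 T])
    fix y z assume y: "y \<in> carrier G1" and z: "z \<in> carrier G2"
    have "?P y * ?P' z + ?Q y * ?Q' z = (?P' z + ?Q' z) * ?P y"
      using eq y by (simp add: algebra_simps)
    then show "?P y * ?P' z + ?Q y * ?Q' z = 0 \<longleftrightarrow>
        \<not> (y \<in> gr_supp G1 ?P \<and> z \<in> gr_supp G2 (gr_add ?P' ?Q'))"
      using split[OF nonneg(3,4,1), of z z y] y z by (auto simp: gr_supp_def gr_add_def)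
  qed (auto simp: gr_supp_def)
  show ?thesis
    unfolding real1 real2 using iff theta1 theta2 by blast
qed

end
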